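(* Let $n\ge 1$ and $\mu\in(0,2)$. There is a constant $C>0$ depending only on $n$ and $\mu$ such that the following holds. Let $u_0\in H^1({\bf R}^n)\cap L^1({\bf R}^n)$ and $u_1\in L^2({\bf R}^n)\cap L^{1,1}({\bf R}^n)$, and let $u(t,x)$ be the solution of $$u_{tt}-\Delta u+\mu L u_t=0\ \text{ in }(0,\infty)\times{\bf R}^n,\qquad u(0,x)=u_0(x),\quad u_t(0,x)=u_1(x),\ x\in{\bf R}^n.$$ Then $$\big\Vert u(t,\cdot)-{\cal F}^{-1}_{\xi\to x}\big(\chi(t,\xi)\big)(\cdot)\big\Vert\le C\big(\Vert u_1\Vert_{1,1}+\Vert u_0\Vert_1\big)\,t^{-\frac n2}$$ for all sufficiently large $t$, where, with $r=|\xi|$, $$\chi(t,\xi):=(1+r)^{-\frac{t\mu}{2}}\,\frac{2}{r\sqrt{4-\left(\frac{\mu\log(1+r)}{r}\right)^2}}\,\sin\left(\frac{r\sqrt{4-\mu^2}}{2}\,t\right)P_1,\qquad P_1:=\int_{{\bf R}^n}u_1(x)\,dx .$$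
   Context: Fourier transform: ${\cal F}_{x\to\xi}(f)(\xi)=\hat f(\xi)=\int_{{\bf R}^n}e^{-ix\cdot\xi}f(x)\,dx$, with inverse ${\cal F}^{-1}_{\xi\to x}$. The operator $L=\log(I+(-\Delta)^{1/2})$ on $L^2({\bf R}^n)$ is the Fourier multiplier $(Lf)(x)={\cal F}^{-1}_{\xi\to x}(\log(1+|\xi|)\hat f(\xi))(x)$ with domain $D(L)=\{f\in L^2:\int(1+\log^2(1+|\xi|))|\hat f(\xi)|^2d\xi<\infty\}$. For $(u_0,u_1)\in H^1({\bf R}^n)\times L^2({\bf R}^n)$ "the solution" is the unique mild solution $u\in C([0,\infty);H^1({\bf R}^n))\cap C^1([0,\infty);L^2({\bf R}^n))$; equivalently, $w(t,\xi)=\hat u(t,\xi)$ (Fourier transform in $x$) solves $w_{tt}+\mu\log(1+|\xi|)w_t+|\xi|^2w=0$, $w(0,\xi)=\hat u_0(\xi)$, $w_t(0,\xi)=\hat u_1(\xi)$. Norms: $\Vert\cdot\Vert_q$ is the $L^q({\bf R}^n)$-norm, $\Vert\cdot\Vert=\Vert\cdot\Vert_2$, and $L^{1,1}({\bf R}^n)=\{f\in L^1:\Vert f\Vert_{1,1}:=\int_{{\bf R}^n}(1+|x|)|f(x)|dx<\infty\}$. The function $\chi(t,\cdot)$ is defined for $\xi\neq0$ (almost everywhere). *)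

theory Defs
  imports "HOL-Analysis.Analysis"
begin

text \<open>Elements of the function spaces are complex-valued Borel functions on \<open>real ^ 'n\<close>, and
  equality in these spaces means equality almost everywhere. No class is lost: every
  Lebesgue measurable function agrees almost everywhere with a Borel function. The dimension is
  \<open>CARD('n)\<close>.\<close>

definition L1_space :: "(real ^ 'n \<Rightarrow> complex) set" where
  "L1_space = {f. integrable lborel f}"

definition L1_norm :: "(real ^ 'n \<Rightarrow> complex) \<Rightarrow> real" where
  "L1_norm f = (LINT x|lborel. cmod (f x))"

definition L11_space :: "(real ^ 'n \<Rightarrow> complex) set" where
  "L11_space = {f \<in> L1_space. integrable lborel (\<lambda>x. (1 + norm x) * cmod (f x))}"

definition L11_norm :: "(real ^ 'n \<Rightarrow> complex) \<Rightarrow> real" where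
  "L11_norm f = (LINT x|lborel. (1 + norm x) * cmod (f x))"

definition L2_space :: "(real ^ 'n \<Rightarrow> complex) set" where
  "L2_space = {f \<in> borel_measurable lborel. integrable lborel (\<lambda>x. (cmod (f x))\<^sup>2)}"

definition L2_norm :: "(real ^ 'n \<Rightarrow> complex) \<Rightarrow> real" where
  "L2_norm f = sqrt (LINT x|lborel. (cmod (f x))\<^sup>2)"

definition fourier_integral :: "(real ^ 'n \<Rightarrow> complex) \<Rightarrow> real ^ 'n \<Rightarrow> complex" where
  "fourier_integral f \<xi> = (LINT x|lborel. exp (- \<i> * complex_of_real (x \<bullet> \<xi>)) * f x)"

text \<open>The Fourier--Plancherel transform: \<open>g\<close> is the limit in mean square, as \<open>R\<close> tends to
  infinity, of the Fourier integrals of \<open>f\<close> over the balls of radius \<open>R\<close> (\<open>f\<close> restricted to a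
  ball is integrable). By Plancherel's theorem this is the graph of a bijection
  of \<open>L\<^sup>2\<close>, up to equality almost everywhere, so both choices below are well defined as
  elements of \<open>L\<^sup>2\<close> whenever their argument is in \<open>L\<^sup>2\<close>; on integrable \<open>f\<close> in \<open>L\<^sup>2\<close>
  the transform is \<^const>\<open>fourier_integral\<close>.\<close>

definition has_fourier :: "(real ^ 'n \<Rightarrow> complex) \<Rightarrow> (real ^ 'n \<Rightarrow> complex) \<Rightarrow> bool" where
  "has_fourier f g \<longleftrightarrow> f \<in> L2_space \<and> g \<in> L2_space \<and>
     ((\<lambda>R. \<integral>\<^sup>+\<xi>. ennreal ((cmod (fourier_integral (\<lambda>x. indicator (cball 0 R) x * f x) \<xi> - g \<xi>))\<^sup>2)
        \<partial>lborel) \<longlongrightarrow> 0) at_top"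

definition fourier :: "(real ^ 'n \<Rightarrow> complex) \<Rightarrow> real ^ 'n \<Rightarrow> complex" where
  "fourier f = (SOME g. has_fourier f g)"

definition inverse_fourier :: "(real ^ 'n \<Rightarrow> complex) \<Rightarrow> real ^ 'n \<Rightarrow> complex" where
  "inverse_fourier g = (SOME f. has_fourier f g)"

definition H1_space :: "(real ^ 'n \<Rightarrow> complex) set" where
  "H1_space = {f \<in> L2_space. integrable lborel (\<lambda>\<xi>. (1 + (norm \<xi>)\<^sup>2) * (cmod (fourier f \<xi>))\<^sup>2)}"

definition H1_norm :: "(real ^ 'n \<Rightarrow> complex) \<Rightarrow> real" where
  "H1_norm f = sqrt (LINT \<xi>|lborel. (1 + (norm \<xi>)\<^sup>2) * (cmod (fourier f \<xi>))\<^sup>2)"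

definition continuous_wrt ::
  "((real ^ 'n \<Rightarrow> complex) \<Rightarrow> real) \<Rightarrow> (real \<Rightarrow> real ^ 'n \<Rightarrow> complex) \<Rightarrow> bool" where
  "continuous_wrt N u \<longleftrightarrow>
     (\<forall>s\<ge>0. ((\<lambda>t. N (\<lambda>x. u t x - u s x)) \<longlongrightarrow> 0) (at s within {0..}))"

definition has_L2_derivative ::
  "(real \<Rightarrow> real ^ 'n \<Rightarrow> complex) \<Rightarrow> (real \<Rightarrow> real ^ 'n \<Rightarrow> complex) \<Rightarrow> bool" where
  "has_L2_derivative u v \<longleftrightarrow>
     (\<forall>s\<ge>0. ((\<lambda>t. L2_norm (\<lambda>x. (u t x - u s x) /\<^sub>R (t - s) - v s x)) \<longlongrightarrow> 0) (at s within {0..}))"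

text \<open>The Fourier symbol of \<open>L = log (I + (-\<Delta>)\<^sup>1\<^sup>/\<^sup>2)\<close>.\<close>

definition L_symbol :: "real ^ 'n \<Rightarrow> real" where
  "L_symbol \<xi> = ln (1 + norm \<xi>)"

text \<open>The solution of \<open>u\<^sub>t\<^sub>t - \<Delta>u + \<mu>Lu\<^sub>t = 0\<close> with data \<open>u0\<close>, \<open>u1\<close>: it lies in
  \<open>C([0,\<infinity>);H\<^sup>1) \<inter> C\<^sup>1([0,\<infinity>);L\<^sup>2)\<close>, takes the initial data, and its spatial Fourier
  transform solves the transformed equation for almost every frequency. Since the transform of
  each \<open>u t\<close> is only an almost-everywhere class, the last clause asks for representatives
  \<open>w t\<close> for which the ordinary differential equation in \<open>t\<close> makes sense.\<close>

definition mild_solution ::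
  "real \<Rightarrow> (real ^ 'n \<Rightarrow> complex) \<Rightarrow> (real ^ 'n \<Rightarrow> complex) \<Rightarrow>
     (real \<Rightarrow> real ^ 'n \<Rightarrow> complex) \<Rightarrow> bool" where
  "mild_solution \<mu> u0 u1 u \<longleftrightarrow>
     (\<forall>t\<ge>0. u t \<in> H1_space) \<and> continuous_wrt H1_norm u \<and>
     (AE x in lborel. u 0 x = u0 x) \<and>
     (\<exists>v. (\<forall>t\<ge>0. v t \<in> L2_space) \<and> continuous_wrt L2_norm v \<and> has_L2_derivative u v \<and>
        (AE x in lborel. v 0 x = u1 x)) \<and>
     (\<exists>w w' w''.
        (\<forall>t\<ge>0. AE \<xi> in lborel. w t \<xi> = fourier (u t) \<xi>) \<and>
        (AE \<xi> in lborel.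
           w 0 \<xi> = fourier u0 \<xi> \<and> w' 0 \<xi> = fourier u1 \<xi> \<and>
           (\<forall>t\<ge>0.
              ((\<lambda>s. w s \<xi>) has_vector_derivative w' t \<xi>) (at t within {0..}) \<and>
              ((\<lambda>s. w' s \<xi>) has_vector_derivative w'' t \<xi>) (at t within {0..}) \<and>
              w'' t \<xi> + complex_of_real (\<mu> * L_symbol \<xi>) * w' t \<xi>
                + complex_of_real ((norm \<xi>)\<^sup>2) * w t \<xi> = 0)))"

text \<open>The asymptotic profile on the Fourier side; its value at \<open>\<xi> = 0\<close> is irrelevant.\<close>

definition profile :: "real \<Rightarrow> complex \<Rightarrow> real \<Rightarrow> real ^ 'n \<Rightarrow> complex" where
  "profile \<mu> P\<^sub>1 t \<xi> = (let r = norm \<xi> in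
     complex_of_real
       ((1 + r) powr (- (t * \<mu> / 2))
        * (2 / (r * sqrt (4 - (\<mu> * ln (1 + r) / r)\<^sup>2)))
        * sin (r * sqrt (4 - \<mu>\<^sup>2) / 2 * t)) * P\<^sub>1)"

end

theory Submission
  imports Defs "HOL-Probability.Characteristic_Functions" "HOL-Probability.Sinc_Integral"
begin

text \<open>Write \<open>r = norm \<xi>\<close>. For a fixed frequency \<open>\<xi> \<noteq> 0\<close> the transformed equation is a damped
  oscillator with damping \<open>a = \<mu> log(1 + r) / 2\<close> and frequency \<open>\<omega>\<close>, \<open>\<omega>\<^sup>2 = r\<^sup>2 - a\<^sup>2\<close>. Because
  \<open>\<mu> < 2\<close> and \<open>log(1 + r) \<le> r\<close>, it is never overdamped: \<open>\<omega> \<ge> r \<kappa> / 2\<close> with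
  \<open>\<kappa> = sqrt(4 - \<mu>\<^sup>2) > 0\<close>. Hence (\<open>damped_oscillator_solution\<close>), with \<open>w\<^sub>0\<close> and \<open>w\<^sub>1\<close> the
  transforms of the data,
  \<open>w(t) = (1 + r)\<^sup>-\<^sup>t\<^sup>\<mu>\<^sup>/\<^sup>2 (cos(\<omega>t) w\<^sub>0 + (sin(\<omega>t) / \<omega>) (w\<^sub>1 + a w\<^sub>0))\<close>.

  Three changes turn this into the profile, and each costs at most a constant times
  \<open>(L11_norm u1 + L1_norm u0) (1 + r t) (1 + r)\<^sup>-\<^sup>t\<^sup>\<mu>\<^sup>/\<^sup>2\<close> (\<open>solution_minus_profile_bound\<close>). Dropping
  the terms with \<open>w\<^sub>0\<close> is harmless since \<open>w\<^sub>0\<close> is bounded by the \<open>L\<^sup>1\<close> norm of \<open>u0\<close> and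
  \<open>a / \<omega>\<close> is bounded. Replacing \<open>w\<^sub>1(\<xi>)\<close> by its value at the origin costs \<open>O(r)\<close> by the
  first moment of \<open>u1\<close>, which cancels the factor \<open>1 / \<omega>\<close>. Replacing \<open>\<omega>\<close> by \<open>r \<kappa> / 2\<close> inside
  the sine costs \<open>t |\<omega> - r \<kappa> / 2| = O(t r\<^sup>2)\<close>, since \<open>1 - log(1 + r) / r = O(r)\<close>, and again one power
  of \<open>r\<close> is cancelled. The substitution \<open>\<xi> = \<eta> / t\<close> and the monotonicity of
  \<open>(1 + \<rho> / t)\<^sup>t\<close> in \<open>t\<close> show that the square of the common majorant has an integral of order
  \<open>t\<^sup>-\<^sup>n\<close> (\<open>decay_weight_integral_bound\<close>).

  It remains to carry the estimate back to \<open>u\<close>. Since \<open>fourier\<close> and \<open>inverse_fourier\<close> choose an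
  image and a preimage under \<open>has_fourier\<close>, this needs the whole Plancherel theorem: existence of
  the transform on \<open>L\<^sup>2\<close>, isometry up to a constant, and surjectivity. The isometry on
  \<open>L\<^sup>1 \<inter> L\<^sup>2\<close> comes from a Gaussian regularisation: the integral of the squared transform against
  a Gaussian is a Gaussian average of the autocorrelation of \<open>f\<close>, which is continuous at
  \<open>0\<close> because translation is continuous in \<open>L\<^sup>2\<close>. Completeness of \<open>L\<^sup>2\<close> then gives existence, and
  surjectivity follows from the isometry together with the symmetry of the transform under the
  bilinear pairing (\<open>has_fourier_surjective\<close>).\<close>

section \<open>Continuity of translation in the mean\<close>

lemma integrable_translate:
  fixes f :: "'a::euclidean_space \<Rightarrow> 'b::{banach, second_countable_topology}"
  assumes "integrable lborel f"
  shows "integrable lborel (\<lambda>x. f (x + a))"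
proof -
  have "integrable (distr lborel borel ((+) a)) f"
    using assms by (simp add: lborel_distr_plus)
  then show ?thesis
    by (subst (asm) integrable_distr_eq) (use assms in \<open>auto simp: add.commute\<close>)
qed

lemma integral_translate:
  fixes f :: "'a::euclidean_space \<Rightarrow> 'b::{banach, second_countable_topology}"
  assumes "f \<in> borel_measurable borel"
  shows "(LINT x|lborel. f (x + a)) = (LINT x|lborel. f x)"
proof -
  have "(LINT x|lborel. f x) = (LINT x|distr lborel borel ((+) a). f x)"
    by (simp add: lborel_distr_plus)
  also have "\<dots> = (LINT x|lborel. f (x + a))"
    by (subst integral_distr) (use assms in \<open>auto simp: add.commute\<close>)
  finally show ?thesis by simp
qed

lemma integrable_scaleR_right_iff:
  fixes f :: "'a \<Rightarrow> 'b::{banach, second_countable_topology}"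
  assumes "c \<noteq> 0"
  shows "integrable M (\<lambda>x. c *\<^sub>R f x) \<longleftrightarrow> integrable M f"
proof
  assume "integrable M (\<lambda>x. c *\<^sub>R f x)"
  from integrable_scaleR_right[OF this, of "inverse c"] show "integrable M f"
    using assms by simp
qed simp

lemma integrable_scale:
  fixes f :: "'a::euclidean_space \<Rightarrow> 'b::{banach, second_countable_topology}"
  assumes [measurable]: "f \<in> borel_measurable borel" and "c \<noteq> 0"
  shows "integrable lborel (\<lambda>x. f (c *\<^sub>R x)) \<longleftrightarrow> integrable lborel f"
proof -
  have "integrable lborel f \<longleftrightarrow>
      integrable (density (distr lborel borel (\<lambda>x. 0 + c *\<^sub>R x)) (\<lambda>_. ennreal (\<bar>c\<bar>^DIM('a)))) f"
    using lborel_affine[of c "0::'a"] assms(2) by (simp add: ennreal_power)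
  also have "\<dots> \<longleftrightarrow> integrable lborel (\<lambda>x. f (c *\<^sub>R x))"
    using assms(2) by (subst integrable_density) (auto simp: integrable_distr_eq integrable_scaleR_right_iff)
  finally show ?thesis by simp
qed

lemma integral_scale:
  fixes f :: "'a::euclidean_space \<Rightarrow> 'b::{banach, second_countable_topology}"
  assumes [measurable]: "f \<in> borel_measurable borel" and "c \<noteq> 0"
  shows "(LINT x|lborel. f x) = \<bar>c\<bar> ^ DIM('a) *\<^sub>R (LINT x|lborel. f (c *\<^sub>R x))"
proof -
  have "(LINT x|lborel. f x) =
      (LINT x|density (distr lborel borel (\<lambda>x. 0 + c *\<^sub>R x)) (\<lambda>_. ennreal (\<bar>c\<bar>^DIM('a))). f x)"
    using lborel_affine[of c "0::'a"] assms(2) by (simp add: ennreal_power)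
  also have "\<dots> = \<bar>c\<bar> ^ DIM('a) *\<^sub>R (LINT x|lborel. f (c *\<^sub>R x))"
    by (subst integral_density) (auto simp: integral_distr)
  finally show ?thesis .
qed

text \<open>Continuity of translation passes to limits in the mean: translation preserves integrals, so
  replacing \<open>f\<close> by an approximation \<open>g\<close> changes \<open>f (x + a) - f x\<close> by at most twice the distance of
  \<open>f\<close> and \<open>g\<close>, uniformly in the shift \<open>a\<close>.\<close>

lemma translation_continuous_approx:
  fixes f :: "'a::euclidean_space \<Rightarrow> 'b::{banach, second_countable_topology}"
  assumes f: "integrable lborel f"
    and approx: "\<And>e::real. e > 0 \<Longrightarrow> \<exists>g. integrable lborel g \<and> (LINT x|lborel. norm (f x - g x)) < e \<and>
      (\<lambda>n. LINT x|lborel. norm (g (x + a n) - g x)) \<longlonglongrightarrow> 0"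
  shows "(\<lambda>n. LINT x|lborel. norm (f (x + a n) - f x)) \<longlonglongrightarrow> 0"
proof (rule LIMSEQ_I)
  fix r :: real assume r: "r > 0"
  obtain g where g: "integrable lborel g" "(LINT x|lborel. norm (f x - g x)) < r/3"
    and lim: "(\<lambda>n. LINT x|lborel. norm (g (x + a n) - g x)) \<longlonglongrightarrow> 0"
    using approx[of "r/3"] r by auto
  from LIMSEQ_D[OF lim, of "r/3"] r obtain N where
    N: "\<And>n. n \<ge> N \<Longrightarrow> (LINT x|lborel. norm (g (x + a n) - g x)) < r/3" by auto
  show "\<exists>no. \<forall>n\<ge>no. norm ((LINT x|lborel. norm (f (x + a n) - f x)) - 0) < r"
  proof (intro exI allI impI)
    fix n assume "n \<ge> N"
    have i1: "integrable lborel (\<lambda>x. norm (f x - g x))" using f g by auto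
    have i2: "integrable lborel (\<lambda>x. norm (f (x + a n) - g (x + a n)))"
      using integrable_translate[OF i1, of "a n"] .
    have i3: "integrable lborel (\<lambda>x. norm (g (x + a n) - g x))"
      using integrable_translate[OF g(1), of "a n"] g by auto
    have i4: "integrable lborel (\<lambda>x. norm (f (x + a n) - f x))"
      using integrable_translate[OF f, of "a n"] f by auto
    have "(LINT x|lborel. norm (f (x + a n) - f x)) \<le>
        (LINT x|lborel. norm (f (x + a n) - g (x + a n)) + norm (g (x + a n) - g x) + norm (f x - g x))"
    proof (rule integral_mono)
      fix x
      have "f (x + a n) - f x = (f (x + a n) - g (x + a n)) + (g (x + a n) - g x) + - (f x - g x)"
        by simp
      then show "norm (f (x + a n) - f x) \<le>
          norm (f (x + a n) - g (x + a n)) + norm (g (x + a n) - g x) + norm (f x - g x)"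
        by (metis norm_triangle_le norm_triangle_ineq norm_minus_cancel add_mono order_refl)
    qed (use i1 i2 i3 i4 in auto)
    also have "\<dots> = (LINT x|lborel. norm (f (x + a n) - g (x + a n)))
        + (LINT x|lborel. norm (g (x + a n) - g x)) + (LINT x|lborel. norm (f x - g x))"
      using i1 i2 i3 by simp
    also have "(LINT x|lborel. norm (f (x + a n) - g (x + a n))) = (LINT x|lborel. norm (f x - g x))"
      by (rule integral_translate[of "\<lambda>x. norm (f x - g x)"]) (use i1 in auto)
    finally show "norm ((LINT x|lborel. norm (f (x + a n) - f x)) - 0) < r"
      using g(2) N[OF \<open>n \<ge> N\<close>] by simp
  qed
qed

text \<open>For \<open>x\<close> in an open set \<open>U\<close> the point \<open>x + a n\<close> eventually stays in \<open>U\<close>, so by dominated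
  convergence the overlap of \<open>U\<close> with its translate fills up \<open>U\<close>; as both sets have the same
  measure, their symmetric difference then shrinks to \<open>0\<close>.\<close>

lemma translation_continuous_indicator_open:
  fixes U :: "'a::euclidean_space set"
  assumes U: "open U" "emeasure lborel U < \<infinity>" and a: "a \<longlonglongrightarrow> 0"
  shows "(\<lambda>n. LINT x|lborel. norm (indicator U (x + a n) - indicator U x :: real)) \<longlonglongrightarrow> 0"
proof -
  have [measurable]: "U \<in> sets borel" using U by auto
  have iU: "integrable lborel (indicator U :: 'a \<Rightarrow> real)" using U by auto
  have iT: "integrable lborel (\<lambda>x. indicator U (x + a n) :: real)" for n
    using integrable_translate[OF iU, of "a n"] .
  have iP: "integrable lborel (\<lambda>x. indicator U (x + a n) * indicator U x :: real)" for n
    by (rule Bochner_Integration.integrable_bound[OF iU]) (auto simp: indicator_def)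
  have lim: "(\<lambda>n. LINT x|lborel. (indicator U (x + a n) * indicator U x :: real))
      \<longlonglongrightarrow> (LINT x|lborel. (indicator U x :: real))"
  proof (rule integral_dominated_convergence[where w="indicator U"])
    show "AE x in lborel. (\<lambda>n. indicator U (x + a n) * indicator U x :: real) \<longlonglongrightarrow> indicator U x"
    proof (rule AE_I2)
      fix x
      show "(\<lambda>n. indicator U (x + a n) * indicator U x :: real) \<longlonglongrightarrow> indicator U x"
      proof (cases "x \<in> U")
        case True
        have "(\<lambda>n. x + a n) \<longlonglongrightarrow> x" using tendsto_add[OF tendsto_const a, of x] by simp
        then have "\<forall>\<^sub>F n in sequentially. x + a n \<in> U"
          using topological_tendstoD U(1) True by blast
        then have "\<forall>\<^sub>F n in sequentially. indicator U (x + a n) * indicator U x = (indicator U x :: real)"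
          by eventually_elim (use True in auto)
        then show ?thesis by (rule tendsto_eventually)
      qed auto
    qed
  qed (use iU in \<open>auto simp: indicator_def\<close>)
  have eq: "(LINT x|lborel. norm (indicator U (x + a n) - indicator U x :: real)) =
     2 * (LINT x|lborel. (indicator U x :: real)) - 2 * (LINT x|lborel. (indicator U (x + a n) * indicator U x :: real))" for n
  proof -
    have "(LINT x|lborel. norm (indicator U (x + a n) - indicator U x :: real)) =
      (LINT x|lborel. indicator U (x + a n) + indicator U x - 2 * (indicator U (x + a n) * indicator U x :: real))"
      by (rule Bochner_Integration.integral_cong) (auto simp: indicator_def)
    also have "\<dots> = (LINT x|lborel. (indicator U (x + a n) :: real)) + (LINT x|lborel. (indicator U x::real))
        - 2 * (LINT x|lborel. (indicator U (x + a n) * indicator U x :: real))"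
      using iU iT iP by simp
    also have "(LINT x|lborel. (indicator U (x + a n) :: real)) = (LINT x|lborel. (indicator U x::real))"
      by (rule integral_translate) auto
    finally show ?thesis by simp
  qed
  show ?thesis
    unfolding eq
    using tendsto_diff[OF tendsto_const[of "2 * (LINT x|lborel. (indicator U x :: real))"]
        tendsto_mult[OF tendsto_const[of 2] lim]] by simp
qed

text \<open>Induction over integrable functions leaves the indicators of Borel sets of finite measure, and
  outer regularity of Lebesgue measure approximates those by indicators of open sets.\<close>

theorem translation_continuous_L1:
  fixes f :: "'a::euclidean_space \<Rightarrow> 'b::{banach, second_countable_topology}"
  assumes f: "integrable lborel f" and a: "a \<longlonglongrightarrow> 0"
  shows "(\<lambda>n. LINT x|lborel. norm (f (x + a n) - f x)) \<longlonglongrightarrow> 0"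
  using f
proof (induction rule: integrable_induct)
  case (base A c)
  have [measurable]: "A \<in> sets borel" using base by auto
  have iA: "integrable lborel (\<lambda>x. indicator A x *\<^sub>R c)" using base by auto
  show ?case
  proof (rule translation_continuous_approx[OF iA])
    fix e :: real assume e: "e > 0"
    \<comment> \<open>the summand \<open>1\<close> covers the case \<open>c = 0\<close>\<close>
    define d where "d = e / (norm c + 1)"
    have d: "d > 0" "d * norm c < e"
      using e by (auto simp: d_def field_simps add_pos_nonneg add_nonneg_pos)
    obtain U where U: "open U" "A \<subseteq> U" "emeasure lborel (U - A) < ennreal d"
      using outer_regular_lborel[of A d] d(1) by auto
    have [measurable]: "U \<in> sets borel" using U by auto
    have finU: "emeasure lborel U < \<infinity>"
    proof -
      have "emeasure lborel U \<le> emeasure lborel A + emeasure lborel (U - A)"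
        using emeasure_subadditive[of A lborel "U - A"] U(2) by (auto simp: Un_absorb1)
      also have "\<dots> < \<infinity>" using base(2) U(3) by (auto simp: less_top[symmetric] intro: order_less_trans)
      finally show ?thesis .
    qed
    have "(LINT x|lborel. norm (indicator A x *\<^sub>R c - indicator U x *\<^sub>R c)) =
        (LINT x|lborel. indicator (U - A) x * norm c)"
      by (rule Bochner_Integration.integral_cong) (use U(2) in \<open>auto simp: indicator_def\<close>)
    also have "\<dots> = measure lborel (U - A) * norm c" by simp
    also have "\<dots> \<le> d * norm c"
      using U(3) d(1) by (intro mult_right_mono) (auto simp: measure_def intro!: enn2real_leI)
    finally have 1: "(LINT x|lborel. norm (indicator A x *\<^sub>R c - indicator U x *\<^sub>R c)) < e" using d by simp
    have "(LINT x|lborel. norm (indicator U (x + a n) *\<^sub>R c - indicator U x *\<^sub>R c)) =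
        (LINT x|lborel. norm (indicator U (x + a n) - indicator U x :: real)) * norm c" for n
      by (simp flip: scaleR_left_diff_distrib)
    then have 2: "(\<lambda>n. LINT x|lborel. norm (indicator U (x + a n) *\<^sub>R c - indicator U x *\<^sub>R c)) \<longlonglongrightarrow> 0"
      using tendsto_mult_left_zero[OF translation_continuous_indicator_open[OF U(1) finU a]] by simp
    show "\<exists>g. integrable lborel g \<and> (LINT x|lborel. norm (indicator A x *\<^sub>R c - g x)) < e \<and>
        (\<lambda>n. LINT x|lborel. norm (g (x + a n) - g x)) \<longlonglongrightarrow> 0"
      by (intro exI[of _ "\<lambda>x. indicator U x *\<^sub>R c"] conjI 1 2) (use finU in auto)
  qed
next
  case (add f g)
  have "(\<lambda>n. (LINT x|lborel. norm (f (x + a n) - f x)) + (LINT x|lborel. norm (g (x + a n) - g x))) \<longlonglongrightarrow> 0"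
    using tendsto_add[OF add.IH] by simp
  then show ?case
  proof (rule tendsto_sandwich[OF _ _ tendsto_const, rotated 2], goal_cases)
    case 2
    have "(LINT x|lborel. norm (f (x + a n) + g (x + a n) - (f x + g x))) \<le>
      (LINT x|lborel. norm (f (x + a n) - f x)) + (LINT x|lborel. norm (g (x + a n) - g x))" for n
    proof -
      have i: "integrable lborel (\<lambda>x. f (x + a n))" "integrable lborel (\<lambda>x. g (x + a n))"
        using add.hyps integrable_translate by blast+
      have "(LINT x|lborel. norm (f (x + a n) + g (x + a n) - (f x + g x))) \<le>
        (LINT x|lborel. norm (f (x + a n) - f x) + norm (g (x + a n) - g x))"
        by (rule integral_mono) (use add.hyps i in \<open>auto simp: norm_diff_triangle_ineq\<close>)
      also have "\<dots> = (LINT x|lborel. norm (f (x + a n) - f x)) + (LINT x|lborel. norm (g (x + a n) - g x))"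
        using add.hyps i by (intro Bochner_Integration.integral_add) auto
      finally show ?thesis .
    qed
    then show ?case by auto
  qed auto
next
  case (lim f s)
  show ?case
  proof (rule translation_continuous_approx[OF lim.hyps(4)])
    fix e :: real assume e: "e > 0"
    have "(\<lambda>i. LINT x|lborel. norm (f x - s i x)) \<longlonglongrightarrow> (LINT x|(lborel::'a measure). 0)"
    proof (rule integral_dominated_convergence[where w="\<lambda>x. 3 * norm (f x)"])
      show "AE x in lborel. (\<lambda>i. norm (f x - s i x)) \<longlonglongrightarrow> 0"
      proof (rule AE_I2)
        fix x show "(\<lambda>i. norm (f x - s i x)) \<longlonglongrightarrow> 0"
          using tendsto_norm[OF tendsto_diff[OF tendsto_const[of "f x"] lim.hyps(2)[of x]]] by simp
      qed
      show "AE x in lborel. norm (norm (f x - s i x)) \<le> 3 * norm (f x)" for i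
      proof (rule AE_I2)
        fix x show "norm (norm (f x - s i x)) \<le> 3 * norm (f x)"
          using norm_triangle_ineq4[of "f x" "s i x"] lim.hyps(3)[of x i] by simp
      qed
    qed (use lim.hyps in auto)
    then obtain i where "(LINT x|lborel. norm (f x - s i x)) < e"
      using LIMSEQ_D[of _ "0::real" e] e by fastforce
    then show "\<exists>g. integrable lborel g \<and> (LINT x|lborel. norm (f x - g x)) < e \<and>
        (\<lambda>n. LINT x|lborel. norm (g (x + a n) - g x)) \<longlonglongrightarrow> 0"
      using lim by (intro exI[of _ "s i"]) auto
  qed
qed

section \<open>The space of square integrable functions\<close>

lemma borel_measurable_cnj [measurable]: "cnj \<in> borel_measurable borel"
  by (intro borel_measurable_continuous_onI continuous_intros)

lemma L2_measurable: "f \<in> L2_space \<Longrightarrow> f \<in> borel_measurable borel"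
  by (simp add: L2_space_def)

lemma L2_integrable: "f \<in> L2_space \<Longrightarrow> integrable lborel (\<lambda>x. (cmod (f x))\<^sup>2)"
  by (simp add: L2_space_def)

lemma L2_bound:
  assumes [measurable]: "f \<in> borel_measurable borel" and "integrable lborel g"
    and "AE x in lborel. (cmod (f x))\<^sup>2 \<le> g x"
  shows "f \<in> L2_space"
proof -
  have "AE x in lborel. norm ((cmod (f x))\<^sup>2) \<le> norm (g x)"
    using assms(3) by eventually_elim auto
  then show ?thesis
    using Bochner_Integration.integrable_bound[OF assms(2), of "\<lambda>x. (cmod (f x))\<^sup>2"]
    by (simp add: L2_space_def)
qed

lemma L2_uminus: "f \<in> L2_space \<Longrightarrow> (\<lambda>x. - f x) \<in> L2_space"
  by (simp add: L2_space_def)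

lemma L2_cnj: "f \<in> L2_space \<Longrightarrow> (\<lambda>x. cnj (f x)) \<in> L2_space"
  by (auto simp add: L2_space_def)

lemma L2_scale: "f \<in> L2_space \<Longrightarrow> (\<lambda>x. c * f x) \<in> L2_space"
  by (auto simp add: L2_space_def norm_mult power_mult_distrib)

lemma cmod_add_sq_le: "(cmod (a + b))\<^sup>2 \<le> 2 * (cmod a)\<^sup>2 + 2 * (cmod b)\<^sup>2"
proof -
  have "(cmod (a + b))\<^sup>2 \<le> (cmod a + cmod b)\<^sup>2"
    by (intro power_mono norm_triangle_ineq) auto
  also have "\<dots> \<le> 2 * (cmod a)\<^sup>2 + 2 * (cmod b)\<^sup>2"
    using zero_le_power2[of "cmod a - cmod b"] by (simp add: power2_eq_square algebra_simps)
  finally show ?thesis .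
qed

lemma L2_add:
  assumes "f \<in> L2_space" "g \<in> L2_space"
  shows "(\<lambda>x. f x + g x) \<in> L2_space"
  by (rule L2_bound[where g="\<lambda>x. 2 * (cmod (f x))\<^sup>2 + 2 * (cmod (g x))\<^sup>2"])
    (use assms cmod_add_sq_le in \<open>auto simp: L2_space_def\<close>)

lemma L2_diff:
  assumes "f \<in> L2_space" "g \<in> L2_space"
  shows "(\<lambda>x. f x - g x) \<in> L2_space"
  using L2_add[OF assms(1) L2_uminus[OF assms(2)]] by simp

lemma L2_indicator:
  assumes "f \<in> L2_space" and [measurable]: "A \<in> sets borel"
  shows "(\<lambda>x. indicator A x * f x) \<in> L2_space"
  by (rule L2_bound[OF _ L2_integrable[OF assms(1)]])
    (use assms in \<open>auto simp: L2_space_def indicator_def\<close>)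

lemma L2_mult_integrable:
  assumes "f \<in> L2_space" "g \<in> L2_space"
  shows "integrable lborel (\<lambda>x. f x * g x)"
proof (rule Bochner_Integration.integrable_bound)
  show "integrable lborel (\<lambda>x. (cmod (f x))\<^sup>2 + (cmod (g x))\<^sup>2)"
    using assms by (simp add: L2_space_def)
  have "cmod (f x) * cmod (g x) \<le> (cmod (f x))\<^sup>2 + (cmod (g x))\<^sup>2" for x
    using sum_squares_bound[of "cmod (f x)" "cmod (g x)"]
      mult_nonneg_nonneg[OF norm_ge_zero[of "f x"] norm_ge_zero[of "g x"]] by linarith
  then show "AE x in lborel. norm (f x * g x) \<le> norm ((cmod (f x))\<^sup>2 + (cmod (g x))\<^sup>2)"
    by (auto simp: norm_mult)
qed (use assms in \<open>auto simp: L2_space_def\<close>)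

lemma L2_norm_nonneg [simp]: "0 \<le> L2_norm f"
  by (simp add: L2_norm_def)

lemma L2_norm_square: "(L2_norm f)\<^sup>2 = (LINT x|lborel. (cmod (f x))\<^sup>2)"
  by (simp add: L2_norm_def)

lemma nn_integral_L2:
  "f \<in> L2_space \<Longrightarrow> (\<integral>\<^sup>+x. ennreal ((cmod (f x))\<^sup>2) \<partial>lborel) = ennreal ((L2_norm f)\<^sup>2)"
  unfolding L2_norm_square by (rule nn_integral_eq_integral) (auto simp: L2_space_def)

lemma L2_norm_cong_AE:
  assumes "AE x in lborel. f x = g x" "f \<in> borel_measurable borel" "g \<in> borel_measurable borel"
  shows "L2_norm f = L2_norm g"
  unfolding L2_norm_def
  by (rule arg_cong[where f=sqrt], rule integral_cong_AE) (use assms in auto)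

lemma L2_norm_eq_0_AE:
  assumes "f \<in> L2_space" "L2_norm f = 0"
  shows "AE x in lborel. f x = 0"
proof -
  have "(LINT x|lborel. (cmod (f x))\<^sup>2) = 0"
    using assms(2) by (metis L2_norm_square zero_power2)
  then show ?thesis
    using integral_nonneg_eq_0_iff_AE[OF L2_integrable[OF assms(1)]] by auto
qed

lemma L2_Cauchy_Schwarz:
  assumes f: "f \<in> L2_space" and g: "g \<in> L2_space"
  shows "cmod (LINT x|lborel. f x * g x) \<le> L2_norm f * L2_norm g"
proof -
  let ?I = "LINT x|lborel. cmod (f x) * cmod (g x)"
  have i: "integrable lborel (\<lambda>x. cmod (f x) * cmod (g x))"
    using integrable_norm[OF L2_mult_integrable[OF f g]] by (simp add: norm_mult)
  have "ennreal (?I\<^sup>2) = (\<integral>\<^sup>+x. ennreal (cmod (f x)) * ennreal (cmod (g x)) \<partial>lborel)\<^sup>2"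
    using nn_integral_eq_integral[OF i] by (simp add: ennreal_mult' ennreal_power)
  also have "\<dots> \<le> (\<integral>\<^sup>+x. (ennreal (cmod (f x)))\<^sup>2 \<partial>lborel) * (\<integral>\<^sup>+x. (ennreal (cmod (g x)))\<^sup>2 \<partial>lborel)"
    by (rule Cauchy_Schwarz_nn_integral) (use f g in \<open>auto simp: L2_space_def\<close>)
  also have "\<dots> = ennreal ((L2_norm f * L2_norm g)\<^sup>2)"
    using nn_integral_L2[OF f] nn_integral_L2[OF g]
    by (simp add: ennreal_power power_mult_distrib ennreal_mult)
  finally have "?I\<^sup>2 \<le> (L2_norm f * L2_norm g)\<^sup>2" by (subst (asm) ennreal_le_iff) auto
  then have "?I \<le> L2_norm f * L2_norm g" by (rule power2_le_imp_le) simp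
  moreover have "cmod (LINT x|lborel. f x * g x) \<le> ?I"
    using integral_norm_bound[of lborel "\<lambda>x. f x * g x"] by (simp add: norm_mult)
  ultimately show ?thesis by simp
qed

lemma L2_norm_cnj [simp]: "L2_norm (\<lambda>x. cnj (f x)) = L2_norm f"
  by (simp add: L2_norm_def)

lemma L2_norm_scale: "L2_norm (\<lambda>x. c * f x) = cmod c * L2_norm f"
  by (simp add: L2_norm_def norm_mult power_mult_distrib real_sqrt_mult)

lemma L2_inner_self: "(LINT x|lborel. f x * cnj (f x)) = complex_of_real ((L2_norm f)\<^sup>2)"
  by (simp only: L2_norm_square integral_complex_of_real[symmetric] complex_norm_square)

lemma L2_norm_add_square:
  assumes f: "f \<in> L2_space" and g: "g \<in> L2_space"
  shows "(L2_norm (\<lambda>x. f x + g x))\<^sup>2 =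
    (L2_norm f)\<^sup>2 + (L2_norm g)\<^sup>2 + 2 * Re (LINT x|lborel. f x * cnj (g x))"
proof -
  have i: "integrable lborel (\<lambda>x. f x * cnj (g x))"
    using L2_mult_integrable[OF f L2_cnj[OF g]] .
  have "(cmod (a + b))\<^sup>2 = (cmod a)\<^sup>2 + (cmod b)\<^sup>2 + 2 * Re (a * cnj b)" for a b
    unfolding cmod_power2 by (simp add: power2_eq_square algebra_simps)
  then have "(L2_norm (\<lambda>x. f x + g x))\<^sup>2 =
      (LINT x|lborel. (cmod (f x))\<^sup>2 + (cmod (g x))\<^sup>2 + 2 * Re (f x * cnj (g x)))"
    by (simp add: L2_norm_square)
  also have "\<dots> = (L2_norm f)\<^sup>2 + (L2_norm g)\<^sup>2 + 2 * (LINT x|lborel. Re (f x * cnj (g x)))"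
    using L2_integrable[OF f] L2_integrable[OF g] integrable_Re[OF i]
    by (simp add: L2_norm_square del: times_complex.sel)
  also have "(LINT x|lborel. Re (f x * cnj (g x))) = Re (LINT x|lborel. f x * cnj (g x))"
    using i by (rule integral_Re)
  finally show ?thesis .
qed

lemma L2_norm_triangle:
  assumes f: "f \<in> L2_space" and g: "g \<in> L2_space"
  shows "L2_norm (\<lambda>x. f x + g x) \<le> L2_norm f + L2_norm g"
proof (rule power2_le_imp_le)
  have "Re (LINT x|lborel. f x * cnj (g x)) \<le> L2_norm f * L2_norm g"
    using complex_Re_le_cmod[of "LINT x|lborel. f x * cnj (g x)"]
      L2_Cauchy_Schwarz[OF f L2_cnj[OF g]] by simp
  then show "(L2_norm (\<lambda>x. f x + g x))\<^sup>2 \<le> (L2_norm f + L2_norm g)\<^sup>2"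
    unfolding L2_norm_add_square[OF f g] by (simp add: power2_sum)
qed simp

lemma L2_norm_uminus: "L2_norm (\<lambda>x. - f x) = L2_norm f"
  by (simp add: L2_norm_def)

lemma L2_norm_diff_le:
  assumes f: "f \<in> L2_space" and g: "g \<in> L2_space"
  shows "\<bar>L2_norm f - L2_norm g\<bar> \<le> L2_norm (\<lambda>x. f x - g x)"
proof -
  have "L2_norm f \<le> L2_norm (\<lambda>x. f x - g x) + L2_norm g"
    using L2_norm_triangle[OF L2_diff[OF f g] g] by simp
  moreover have "L2_norm g \<le> L2_norm f + L2_norm (\<lambda>x. f x - g x)"
    using L2_norm_triangle[OF f L2_uminus[OF L2_diff[OF f g]]]
      L2_norm_uminus[of "\<lambda>x. f x - g x"] by simp
  ultimately show ?thesis by linarith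
qed

lemma L2_translate:
  assumes "f \<in> L2_space"
  shows "(\<lambda>x. f (x + a)) \<in> L2_space" "L2_norm (\<lambda>x. f (x + a)) = L2_norm f"
proof -
  show "(\<lambda>x. f (x + a)) \<in> L2_space"
    using integrable_translate[OF L2_integrable[OF assms], of a] L2_measurable[OF assms]
    by (simp add: L2_space_def)
  show "L2_norm (\<lambda>x. f (x + a)) = L2_norm f"
    unfolding L2_norm_def
    by (rule arg_cong[where f=sqrt], rule integral_translate[of "\<lambda>x. (cmod (f x))\<^sup>2"])
      (use assms in \<open>auto simp: L2_space_def\<close>)
qed

text \<open>This elementary inequality is what turns a statement on integrable functions into one on square
  integrable functions: for nonnegative functions it bounds the distance in the mean square by
  the distance of the squares in the mean.\<close>

lemma square_diff_le_diff_squares: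
  fixes a b :: real
  assumes "0 \<le> a" "0 \<le> b"
  shows "(a - b)\<^sup>2 \<le> \<bar>a\<^sup>2 - b\<^sup>2\<bar>"
proof -
  have "(a - b)\<^sup>2 = \<bar>a - b\<bar> * \<bar>a - b\<bar>" by (simp add: power2_eq_square)
  also have "\<dots> \<le> \<bar>a - b\<bar> * (a + b)" using assms by (intro mult_left_mono) auto
  also have "\<dots> = \<bar>a\<^sup>2 - b\<^sup>2\<bar>"
    using assms by (simp add: abs_mult power2_eq_square square_diff_square_factored mult.commute)
  finally show ?thesis .
qed

lemma square_diff_le_parts:
  fixes a b :: real
  shows "(a - b)\<^sup>2 \<le> 2 * (\<bar>(max a 0)\<^sup>2 - (max b 0)\<^sup>2\<bar> + \<bar>(max (-a) 0)\<^sup>2 - (max (-b) 0)\<^sup>2\<bar>)"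
proof -
  let ?p = "max a 0 - max b 0" and ?m = "max (-a) 0 - max (-b) 0"
  have "(a - b)\<^sup>2 = (?p - ?m)\<^sup>2" by (auto simp: max_def)
  also have "\<dots> \<le> 2 * (?p\<^sup>2 + ?m\<^sup>2)"
    using zero_le_power2[of "?p + ?m"] by (simp add: power2_eq_square algebra_simps)
  also have "\<dots> \<le> 2 * (\<bar>(max a 0)\<^sup>2 - (max b 0)\<^sup>2\<bar> + \<bar>(max (-a) 0)\<^sup>2 - (max (-b) 0)\<^sup>2\<bar>)"
    by (intro mult_left_mono add_mono square_diff_le_diff_squares) auto
  finally show ?thesis .
qed

text \<open>Split \<open>f\<close> into the positive and negative parts of its real and imaginary part. The squares of
  these four functions are integrable, and \<open>square_diff_le_parts\<close> bounds the square of
  \<open>f (x + a) - f x\<close> by the increments of the four squares, so that \<open>translation_continuous_L1\<close>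
  applies.\<close>

theorem translation_continuous_L2:
  fixes f :: "real ^ 'n \<Rightarrow> complex"
  assumes f: "f \<in> L2_space" and a: "a \<longlonglongrightarrow> 0"
  shows "(\<lambda>n. L2_norm (\<lambda>x. f (x + a n) - f x)) \<longlonglongrightarrow> 0"
proof -
  have [measurable]: "f \<in> borel_measurable borel" using f by (rule L2_measurable)
  define Q where "Q i x = (if i = (0::nat) then (max (Re (f x)) 0)\<^sup>2 else if i = 1 then (max (- Re (f x)) 0)\<^sup>2
      else if i = 2 then (max (Im (f x)) 0)\<^sup>2 else (max (- Im (f x)) 0)\<^sup>2)" for i x
  have iQ: "integrable lborel (Q i)" for i
  proof (rule Bochner_Integration.integrable_bound[OF L2_integrable[OF f]])
    show "Q i \<in> borel_measurable lborel" unfolding Q_def by measurable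
    have "\<bar>max r 0\<bar> \<le> \<bar>r\<bar>" "\<bar>max (- r) 0\<bar> \<le> \<bar>r\<bar>" for r :: real by auto
    then have "(max r 0)\<^sup>2 \<le> r\<^sup>2" "(max (- r) 0)\<^sup>2 \<le> r\<^sup>2" for r :: real
      by (metis abs_le_square_iff)+
    then have "Q i x \<le> (cmod (f x))\<^sup>2" for x
      unfolding Q_def cmod_power2 by (auto intro: add_increasing add_increasing2)
    then show "AE x in lborel. norm (Q i x) \<le> norm ((cmod (f x))\<^sup>2)"
      by (auto simp: Q_def)
  qed
  have sum4: "(\<Sum>i<4. F i) = F 0 + F 1 + F 2 + F (3::nat)" for F :: "nat \<Rightarrow> real"
    by (simp add: eval_nat_numeral)
  have bound: "(L2_norm (\<lambda>x. f (x + a n) - f x))\<^sup>2 \<le> 2 * (\<Sum>i<4. LINT x|lborel. norm (Q i (x + a n) - Q i x))" for n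
  proof -
    have i: "integrable lborel (\<lambda>x. norm (Q i (x + a n) - Q i x))" for i
      using integrable_translate[OF iQ, of i "a n"] iQ by auto
    have "(L2_norm (\<lambda>x. f (x + a n) - f x))\<^sup>2 \<le>
        (LINT x|lborel. 2 * (\<Sum>i<4. norm (Q i (x + a n) - Q i x)))"
      unfolding L2_norm_square
    proof (rule integral_mono)
      show "integrable lborel (\<lambda>x. (cmod (f (x + a n) - f x))\<^sup>2)"
        using L2_diff[OF L2_translate(1)[OF f] f] by (rule L2_integrable)
      fix x
      have "(cmod (f (x + a n) - f x))\<^sup>2 = (Re (f (x + a n)) - Re (f x))\<^sup>2 + (Im (f (x + a n)) - Im (f x))\<^sup>2"
        by (simp add: cmod_power2)
      also have "\<dots> \<le> 2 * (norm (Q 0 (x + a n) - Q 0 x) + norm (Q 1 (x + a n) - Q 1 x))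
          + 2 * (norm (Q 2 (x + a n) - Q 2 x) + norm (Q 3 (x + a n) - Q 3 x))"
        by (rule add_mono; use square_diff_le_parts in \<open>simp add: Q_def\<close>)
      finally show "(cmod (f (x + a n) - f x))\<^sup>2 \<le> 2 * (\<Sum>i<4. norm (Q i (x + a n) - Q i x))"
        unfolding sum4 by (simp only: distrib_left add.assoc)
    qed (use i in auto)
    also have "\<dots> = 2 * (\<Sum>i<4. LINT x|lborel. norm (Q i (x + a n) - Q i x))"
      using i by (simp only: integral_mult_right_zero Bochner_Integration.integral_sum)
    finally show ?thesis .
  qed
  have lim: "(\<lambda>n. 2 * (\<Sum>i<4. LINT x|lborel. norm (Q i (x + a n) - Q i x))) \<longlonglongrightarrow> 2 * (\<Sum>i<(4::nat). 0)"
    by (rule tendsto_mult[OF tendsto_const], rule tendsto_sum, rule translation_continuous_L1[OF iQ a])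
  have "(\<lambda>n. (L2_norm (\<lambda>x. f (x + a n) - f x))\<^sup>2) \<longlonglongrightarrow> 0"
    by (rule Lim_null_comparison[OF _ lim[unfolded sum.neutral_const mult_zero_right]])
      (use bound in simp)
  from tendsto_real_sqrt[OF this] show ?thesis by simp
qed

text \<open>The autocorrelation of \<open>f\<close> is continuous at \<open>0\<close>, where its value is the square of the norm. This
  is how the norm of \<open>f\<close> enters Plancherel's identity.\<close>

lemma autocorrelation_tendsto:
  fixes f :: "real ^ 'n \<Rightarrow> complex"
  assumes f: "f \<in> L2_space" and a: "a \<longlonglongrightarrow> 0"
  shows "(\<lambda>n. LINT x|lborel. f x * cnj (f (x + a n))) \<longlonglongrightarrow> complex_of_real ((L2_norm f)\<^sup>2)"
proof -
  have bound: "cmod ((LINT x|lborel. f x * cnj (f (x + a n))) - complex_of_real ((L2_norm f)\<^sup>2))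
      \<le> L2_norm f * L2_norm (\<lambda>x. f (x + a n) - f x)" for n
  proof -
    let ?g = "\<lambda>x. f (x + a n)"
    have "(LINT x|lborel. f x * cnj (?g x - f x)) =
        (LINT x|lborel. f x * cnj (?g x) - f x * cnj (f x))"
      by (rule Bochner_Integration.integral_cong) (simp_all add: right_diff_distrib)
    also have "\<dots> = (LINT x|lborel. f x * cnj (?g x)) - (LINT x|lborel. f x * cnj (f x))"
      using L2_mult_integrable[OF f L2_cnj[OF L2_translate(1)[OF f, of "a n"]]]
        L2_mult_integrable[OF f L2_cnj[OF f]]
      by (rule Bochner_Integration.integral_diff)
    finally have "(LINT x|lborel. f x * cnj (f (x + a n))) - complex_of_real ((L2_norm f)\<^sup>2) =
        (LINT x|lborel. f x * cnj (f (x + a n) - f x))"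
      by (simp only: L2_inner_self)
    then show ?thesis
      using L2_Cauchy_Schwarz[OF f L2_cnj[OF L2_diff[OF L2_translate(1)[OF f, of "a n"] f]]]
      unfolding L2_norm_cnj by (simp only:)
  qed
  have "(\<lambda>n. (LINT x|lborel. f x * cnj (f (x + a n))) - complex_of_real ((L2_norm f)\<^sup>2)) \<longlonglongrightarrow> 0"
    by (rule Lim_null_comparison[OF _ tendsto_mult_right_zero[OF translation_continuous_L2[OF f a], of "L2_norm f"]])
      (use bound in simp)
  then show ?thesis by (rule LIM_zero_cancel)
qed

section \<open>Gaussians and the Fourier integral\<close>

text \<open>Lebesgue measure is the image of the product of one-dimensional Lebesgue measures under the
  coordinate map, so integrals of products of functions of one coordinate each factorise.\<close>

lemma
  fixes f :: "'a::euclidean_space \<Rightarrow> real \<Rightarrow> 'b::{real_normed_field, banach, second_countable_topology}"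
  assumes f: "\<And>b. b \<in> Basis \<Longrightarrow> integrable lborel (f b)"
  shows integrable_prod_Basis: "integrable lborel (\<lambda>x. \<Prod>b\<in>Basis. f b (x \<bullet> b))"
    and integral_prod_Basis:
      "(LINT x|lborel. (\<Prod>b\<in>Basis. f b (x \<bullet> b))) = (\<Prod>b\<in>Basis. (LINT t|lborel. f b t))"
proof -
  interpret P: product_sigma_finite "\<lambda>_::'a. lborel :: real measure" ..
  have [measurable]: "(\<lambda>x. \<Prod>b\<in>Basis. f b (x \<bullet> b)) \<in> borel_measurable borel"
    using f by (auto intro!: borel_measurable_prod)
  have [measurable]: "(\<lambda>t. \<Sum>b\<in>Basis. t b *\<^sub>R b) \<in> Pi\<^sub>M Basis (\<lambda>_. lborel) \<rightarrow>\<^sub>M (borel :: 'a measure)"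
    by measurable
  have L: "(lborel :: 'a measure) = distr (\<Pi>\<^sub>M b\<in>Basis. lborel) borel (\<lambda>t. \<Sum>b\<in>Basis. t b *\<^sub>R b)"
    by (rule lborel_eq)
  have eq: "(\<Prod>b\<in>Basis. f b ((\<Sum>c\<in>Basis. t c *\<^sub>R c) \<bullet> b)) = (\<Prod>b\<in>Basis. f b (t b))" for t
    by (rule prod.cong) auto
  show "integrable lborel (\<lambda>x. \<Prod>b\<in>Basis. f b (x \<bullet> b))"
    unfolding L
    using P.product_integrable_prod[OF finite_Basis f] by (simp add: integrable_distr_eq eq)
  show "(LINT x|lborel. (\<Prod>b\<in>Basis. f b (x \<bullet> b))) = (\<Prod>b\<in>Basis. (LINT t|lborel. f b t))"
    unfolding L
    using P.product_integral_prod[OF finite_Basis f] by (simp add: integral_distr eq)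
qed

definition gaussian :: "'a::euclidean_space \<Rightarrow> real" where
  "gaussian x = exp (- (norm x)\<^sup>2 / 2)"

lemma gaussian_nonneg [simp]: "0 \<le> gaussian x" and gaussian_0 [simp]: "gaussian 0 = 1"
  by (simp_all add: gaussian_def)

lemma gaussian_measurable [measurable]: "gaussian \<in> borel_measurable borel"
  unfolding gaussian_def by measurable

lemma gaussian_prod: "gaussian x = (\<Prod>b\<in>Basis. exp (- (x \<bullet> b)\<^sup>2 / 2))"
proof -
  have "(norm x)\<^sup>2 = (\<Sum>b\<in>Basis. (x \<bullet> b)\<^sup>2)"
    unfolding power2_norm_eq_inner by (subst euclidean_inner) (simp add: power2_eq_square)
  then show ?thesis
    by (simp add: gaussian_def exp_sum[symmetric] sum_negf sum_divide_distrib)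
qed

lemma cmod_exp_minus_i [simp]: "cmod (exp (- (\<i> * complex_of_real r))) = 1"
  using norm_exp_i_times[of "- r"] by simp

text \<open>The one-dimensional Gaussian integral is the characteristic function of the standard normal
  distribution, up to the normalising factor.\<close>

lemma std_gaussian_real:
  shows "integrable lborel (\<lambda>x::real. exp (- x\<^sup>2 / 2))"
    and "integrable lborel (\<lambda>x. exp (- \<i> * complex_of_real (x * s)) * complex_of_real (exp (- x\<^sup>2 / 2)))"
    and "(LINT x|lborel. exp (- \<i> * complex_of_real (x * s)) * complex_of_real (exp (- x\<^sup>2 / 2))) =
      complex_of_real (sqrt (2 * pi) * exp (- s\<^sup>2 / 2))"
proof -
  have "integrable lborel (\<lambda>x. std_normal_density x * (x - 0) ^ 0)"
    by (rule integrable_normal_moment) simp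
  from integrable_mult_right[OF this, of "sqrt (2 * pi)"]
  show i: "integrable lborel (\<lambda>x::real. exp (- x\<^sup>2 / 2))"
    by (simp add: std_normal_density_def)
  show "integrable lborel (\<lambda>x. exp (- \<i> * complex_of_real (x * s)) * complex_of_real (exp (- x\<^sup>2 / 2)))"
    by (rule Bochner_Integration.integrable_bound[OF i])
      (auto simp: norm_mult simp del: of_real_mult)
  have "complex_of_real (exp (- (- s)\<^sup>2 / 2)) = char std_normal_distribution (- s)"
    by (simp add: char_std_normal_distribution)
  also have "\<dots> = (LINT x|lborel. std_normal_density x *\<^sub>R iexp (- s * x))"
    unfolding char_def by (subst integral_density) auto
  also have "\<dots> = (LINT x|lborel. complex_of_real (1 / sqrt (2 * pi)) *
      (exp (- \<i> * complex_of_real (x * s)) * complex_of_real (exp (- x\<^sup>2 / 2))))"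
    by (rule Bochner_Integration.integral_cong)
      (auto simp: std_normal_density_def scaleR_conv_of_real mult.commute mult.left_commute)
  also have "\<dots> = complex_of_real (1 / sqrt (2 * pi)) *
      (LINT x|lborel. exp (- \<i> * complex_of_real (x * s)) * complex_of_real (exp (- x\<^sup>2 / 2)))"
    by (rule integral_mult_right_zero)
  finally show "(LINT x|lborel. exp (- \<i> * complex_of_real (x * s)) * complex_of_real (exp (- x\<^sup>2 / 2))) =
      complex_of_real (sqrt (2 * pi) * exp (- s\<^sup>2 / 2))"
    by (simp add: field_simps)
qed

lemma gaussian_integrable [simp]: "integrable lborel (gaussian :: 'a::euclidean_space \<Rightarrow> real)"
  unfolding gaussian_prod
  by (rule integrable_prod_Basis[where f="\<lambda>_ x. exp (- x\<^sup>2 / 2)"]) (rule std_gaussian_real)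

text \<open>Both the inner product in the phase and the square of the norm are sums over the coordinates,
  so the integrand is a product of one-dimensional ones.\<close>

lemma gaussian_fourier:
  fixes y :: "'a::euclidean_space"
  shows "(LINT x|lborel. exp (- \<i> * complex_of_real (x \<bullet> y)) * complex_of_real (gaussian x)) =
    complex_of_real (sqrt (2 * pi) ^ DIM('a) * gaussian y)"
proof -
  have "exp (- \<i> * complex_of_real (x \<bullet> y)) * complex_of_real (gaussian x) =
      (\<Prod>b\<in>Basis. exp (- \<i> * complex_of_real ((x \<bullet> b) * (y \<bullet> b))) * complex_of_real (exp (- (x \<bullet> b)\<^sup>2 / 2)))" for x :: 'a
  proof -
    have "- \<i> * complex_of_real (x \<bullet> y) = (\<Sum>b\<in>Basis. - \<i> * complex_of_real ((x \<bullet> b) * (y \<bullet> b)))"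
      by (subst euclidean_inner) (simp add: sum_distrib_left sum_negf)
    then show ?thesis
      by (simp only: exp_sum[OF finite_Basis] gaussian_prod prod.distrib of_real_prod)
  qed
  then have "(LINT x|lborel. exp (- \<i> * complex_of_real (x \<bullet> y)) * complex_of_real (gaussian x)) =
      (\<Prod>b\<in>Basis. (LINT t|lborel. exp (- \<i> * complex_of_real (t * (y \<bullet> b))) * complex_of_real (exp (- t\<^sup>2 / 2))))"
    using integral_prod_Basis[where f="\<lambda>b t. exp (- \<i> * complex_of_real (t * (y \<bullet> b))) * complex_of_real (exp (- t\<^sup>2 / 2))",
        OF std_gaussian_real(2)] by simp
  also have "\<dots> = complex_of_real (sqrt (2 * pi) ^ DIM('a) * gaussian y)"
    unfolding std_gaussian_real(3)
    by (simp only: gaussian_prod of_real_mult prod.distrib prod_constant of_real_prod of_real_power)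
  finally show ?thesis .
qed

lemma gaussian_integral: "(LINT x|lborel. gaussian (x::'a::euclidean_space)) = sqrt (2 * pi) ^ DIM('a)"
proof -
  have "complex_of_real (LINT x|lborel. gaussian (x::'a)) = complex_of_real (sqrt (2 * pi) ^ DIM('a))"
    using gaussian_fourier[of "0::'a"] by (simp del: of_real_power)
  then show ?thesis by (simp only: of_real_eq_iff)
qed

lemma gaussian_scaled_integrable:
  "e \<noteq> 0 \<Longrightarrow> integrable lborel (\<lambda>x::'a::euclidean_space. gaussian (e *\<^sub>R x))"
  by (simp add: integrable_scale)

lemma gaussian_scaled_fourier:
  fixes y :: "'a::euclidean_space"
  assumes "e > 0"
  shows "(LINT x|lborel. exp (- \<i> * complex_of_real (x \<bullet> y)) * complex_of_real (gaussian (e *\<^sub>R x))) =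
    complex_of_real (sqrt (2 * pi) ^ DIM('a) / e ^ DIM('a) * gaussian (y /\<^sub>R e))"
proof -
  have "(LINT x|lborel. exp (- \<i> * complex_of_real (x \<bullet> y)) * complex_of_real (gaussian (e *\<^sub>R x))) =
    \<bar>1/e\<bar> ^ DIM('a) *\<^sub>R (LINT x|lborel. exp (- \<i> * complex_of_real (((1/e) *\<^sub>R x) \<bullet> y)) * complex_of_real (gaussian (e *\<^sub>R ((1/e) *\<^sub>R x))))"
    by (rule integral_scale) (use assms in auto)
  also have "(LINT x|lborel. exp (- \<i> * complex_of_real (((1/e) *\<^sub>R x) \<bullet> y)) * complex_of_real (gaussian (e *\<^sub>R ((1/e) *\<^sub>R x)))) =
      (LINT x|lborel. exp (- \<i> * complex_of_real (x \<bullet> (y /\<^sub>R e))) * complex_of_real (gaussian x))"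
    using assms by (simp add: divide_inverse mult.commute)
  also have "\<dots> = complex_of_real (sqrt (2 * pi) ^ DIM('a) * gaussian (y /\<^sub>R e))"
    by (rule gaussian_fourier)
  finally show ?thesis
    using assms by (simp add: scaleR_conv_of_real power_divide)
qed

lemma fourier_integrand_integrable:
  fixes f :: "real ^ 'n \<Rightarrow> complex"
  assumes "integrable lborel f"
  shows "integrable lborel (\<lambda>x. exp (- \<i> * complex_of_real (x \<bullet> \<xi>)) * f x)"
  by (rule Bochner_Integration.integrable_bound[OF assms]) (use assms in \<open>auto simp: norm_mult\<close>)

lemma fourier_integral_bound:
  fixes f :: "real ^ 'n \<Rightarrow> complex"
  assumes "integrable lborel f"
  shows "cmod (fourier_integral f \<xi>) \<le> L1_norm f"
  unfolding fourier_integral_def L1_norm_def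
  using integral_norm_bound[of lborel "\<lambda>x. exp (- \<i> * complex_of_real (x \<bullet> \<xi>)) * f x"]
  by (simp add: norm_mult)

lemma fourier_integral_measurable [measurable]:
  fixes f :: "real ^ 'n \<Rightarrow> complex"
  assumes [measurable]: "f \<in> borel_measurable borel"
  shows "fourier_integral f \<in> borel_measurable borel"
  unfolding fourier_integral_def by measurable

lemma fourier_integral_diff:
  fixes f :: "real ^ 'n \<Rightarrow> complex"
  assumes "integrable lborel f" "integrable lborel g"
  shows "fourier_integral (\<lambda>x. f x - g x) \<xi> = fourier_integral f \<xi> - fourier_integral g \<xi>"
  unfolding fourier_integral_def
  using fourier_integrand_integrable[OF assms(1)] fourier_integrand_integrable[OF assms(2)]
  by (simp add: right_diff_distrib)

lemma integrable_mult_bounded: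
  fixes f g :: "real ^ 'n \<Rightarrow> complex"
  assumes f: "integrable lborel f" and [measurable]: "g \<in> borel_measurable borel"
    and "\<And>x. cmod (g x) \<le> B"
  shows "integrable lborel (\<lambda>x. f x * g x)"
proof (rule Bochner_Integration.integrable_bound)
  show "integrable lborel (\<lambda>x. B * cmod (f x))" using f by auto
  have "cmod (f x) * cmod (g x) \<le> cmod (f x) * B" for x
    by (rule mult_left_mono) (use assms in auto)
  moreover have "0 \<le> B" using assms(3)[of 0] norm_ge_zero order_trans by blast
  ultimately show "AE x in lborel. norm (f x * g x) \<le> norm (B * cmod (f x))"
    by (auto simp: norm_mult mult.commute)
qed (use f in auto)

text \<open>By Fubini's theorem both sides are the double integral of
  \<open>exp (- \<i> (x \<bullet> \<xi>)) f(x) g(\<xi>)\<close>.\<close>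

theorem fourier_integral_multiplication:
  fixes f g :: "real ^ 'n \<Rightarrow> complex"
  assumes f: "integrable lborel f" and g: "integrable lborel g"
  shows "(LINT \<xi>|lborel. fourier_integral f \<xi> * g \<xi>) = (LINT x|lborel. f x * fourier_integral g x)"
proof -
  have [measurable]: "f \<in> borel_measurable borel" "g \<in> borel_measurable borel" using f g by auto
  let ?K = "\<lambda>(x::real^'n, \<xi>). exp (- \<i> * complex_of_real (x \<bullet> \<xi>)) * f x * g \<xi>"
  have "integrable (lborel \<Otimes>\<^sub>M lborel) ?K"
  proof (rule lborel_pair.Fubini_integrable)
    show "?K \<in> borel_measurable (lborel \<Otimes>\<^sub>M lborel)" by measurable
    have "(\<lambda>x. LINT \<xi>|lborel. norm (?K (x, \<xi>))) = (\<lambda>x. cmod (f x) * L1_norm g)"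
      by (auto simp: norm_mult L1_norm_def)
    then show "integrable lborel (\<lambda>x. LINT \<xi>|lborel. norm (?K (x, \<xi>)))" using f by simp
    show "AE x in lborel. integrable lborel (\<lambda>\<xi>. ?K (x, \<xi>))"
    proof (rule AE_I2)
      fix x
      show "integrable lborel (\<lambda>\<xi>. ?K (x, \<xi>))"
        by (rule Bochner_Integration.integrable_bound[of _ "\<lambda>\<xi>. f x * g \<xi>"]) (use g in \<open>auto simp: norm_mult\<close>)
    qed
  qed
  from lborel_pair.Fubini_integral[OF this]
  have "(LINT \<xi>|lborel. LINT x|lborel. exp (- \<i> * complex_of_real (x \<bullet> \<xi>)) * f x * g \<xi>) =
      (LINT x|lborel. LINT \<xi>|lborel. exp (- \<i> * complex_of_real (x \<bullet> \<xi>)) * f x * g \<xi>)"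
    by simp
  moreover have "(LINT x|lborel. exp (- \<i> * complex_of_real (x \<bullet> \<xi>)) * f x * g \<xi>) = fourier_integral f \<xi> * g \<xi>" for \<xi>
    unfolding fourier_integral_def by (simp only: integral_mult_left_zero)
  moreover have "(LINT \<xi>|lborel. exp (- \<i> * complex_of_real (x \<bullet> \<xi>)) * f x * g \<xi>) = f x * fourier_integral g x" for x
  proof -
    have "(LINT \<xi>|lborel. exp (- \<i> * complex_of_real (x \<bullet> \<xi>)) * f x * g \<xi>) =
      (LINT \<xi>|lborel. f x * (exp (- \<i> * complex_of_real (\<xi> \<bullet> x)) * g \<xi>))"
      by (rule Bochner_Integration.integral_cong) (simp_all add: mult.left_commute mult.assoc inner_commute)
    then show ?thesis unfolding fourier_integral_def by (simp only: integral_mult_right_zero)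
  qed
  ultimately show ?thesis by (simp only:)
qed

section \<open>The Plancherel identity for integrable functions\<close>

text \<open>The Gaussian factor makes the squared transform absolutely integrable, so that the
  multiplication formula can be applied. Its first use moves one of the two transforms from \<open>h\<close>
  onto the product of the Gaussian and the conjugate of the other transform; a second use shows
  that the outcome is the conjugate of \<open>h\<close> averaged against a Gaussian of width \<open>e\<close>. Rescaling that average
  to the standard Gaussian puts \<open>e\<close> into the argument of \<open>h\<close>, where the limit \<open>e \<rightarrow> 0\<close> can be
  taken.\<close>

lemma gaussian_regularised_Plancherel:
  fixes h :: "real ^ 'n \<Rightarrow> complex"
  assumes h1: "integrable lborel h" and h2: "h \<in> L2_space" and e: "e > 0"
  shows "integrable lborel (\<lambda>\<xi>. (cmod (fourier_integral h \<xi>))\<^sup>2 * gaussian (e *\<^sub>R \<xi>))" (is ?I)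
    and "complex_of_real (LINT \<xi>|lborel. (cmod (fourier_integral h \<xi>))\<^sup>2 * gaussian (e *\<^sub>R \<xi>)) =
      complex_of_real (sqrt (2 * pi) ^ CARD('n)) *
        (LINT z|lborel. complex_of_real (gaussian z) * (LINT x|lborel. h x * cnj (h (x + e *\<^sub>R z))))" (is ?E)
proof -
  let ?F = "fourier_integral h" and ?\<gamma> = "\<lambda>\<xi>::real^'n. complex_of_real (gaussian (e *\<^sub>R \<xi>))"
  let ?K = "complex_of_real (sqrt (2 * pi) ^ CARD('n))"
  have [measurable]: "h \<in> borel_measurable borel" using h1 by auto
  have i\<gamma>: "integrable lborel ?\<gamma>" using gaussian_scaled_integrable[of e] e by auto
  have iF\<gamma>: "integrable lborel (\<lambda>\<xi>. ?\<gamma> \<xi> * ?F \<xi>)"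
    by (rule integrable_mult_bounded[OF i\<gamma>]) (auto intro: fourier_integral_bound[OF h1])
  have iq: "integrable lborel (\<lambda>\<xi>. cnj (?F \<xi>) * ?\<gamma> \<xi>)"
    using integrable_cnj[OF iF\<gamma>] by (simp add: mult.commute)
  have iFq: "integrable lborel (\<lambda>\<xi>. (cnj (?F \<xi>) * ?\<gamma> \<xi>) * ?F \<xi>)"
    by (rule integrable_mult_bounded[OF iq]) (auto intro: fourier_integral_bound[OF h1])
  have sq: "(cnj (?F \<xi>) * ?\<gamma> \<xi>) * ?F \<xi> = complex_of_real ((cmod (?F \<xi>))\<^sup>2 * gaussian (e *\<^sub>R \<xi>))" for \<xi>
    by (simp only: of_real_mult complex_norm_square mult_ac)
  show ?I using iFq unfolding sq by (simp only: complex_of_real_integrable_eq)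

  have Fq: "fourier_integral (\<lambda>\<xi>. cnj (?F \<xi>) * ?\<gamma> \<xi>) x =
      cnj (?K * (LINT z|lborel. h (x + e *\<^sub>R z) * complex_of_real (gaussian z)))" for x
  proof -
    \<comment> \<open>the modulation by \<open>x\<close> in \<open>?p\<close> becomes a translation of its transform\<close>
    let ?p = "\<lambda>\<xi>. exp (\<i> * complex_of_real (\<xi> \<bullet> x)) * ?\<gamma> \<xi>"
    have ip: "integrable lborel ?p"
      by (rule Bochner_Integration.integrable_bound[OF i\<gamma>]) (auto simp: norm_mult)
    have Fp: "fourier_integral ?p y =
        complex_of_real (sqrt (2 * pi) ^ CARD('n) / e ^ CARD('n) * gaussian ((y - x) /\<^sub>R e))" for y
    proof -
      have "fourier_integral ?p y = (LINT \<xi>|lborel. exp (- \<i> * complex_of_real (\<xi> \<bullet> (y - x))) * ?\<gamma> \<xi>)"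
        unfolding fourier_integral_def
      proof (rule Bochner_Integration.integral_cong[OF refl])
        fix \<xi> :: "real ^ 'n"
        have "- \<i> * complex_of_real (\<xi> \<bullet> y) + \<i> * complex_of_real (\<xi> \<bullet> x) = - \<i> * complex_of_real (\<xi> \<bullet> (y - x))"
          by (simp add: inner_diff_right algebra_simps)
        then show "exp (- \<i> * complex_of_real (\<xi> \<bullet> y)) * ?p \<xi> =
            exp (- \<i> * complex_of_real (\<xi> \<bullet> (y - x))) * ?\<gamma> \<xi>"
          by (simp only: mult.assoc[symmetric] exp_add[symmetric])
      qed
      then show ?thesis by (simp only: gaussian_scaled_fourier[OF e]) simp
    qed
    have "fourier_integral (\<lambda>\<xi>. cnj (?F \<xi>) * ?\<gamma> \<xi>) x = cnj (LINT \<xi>|lborel. ?F \<xi> * ?p \<xi>)"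
    proof -
      have "(LINT \<xi>|lborel. exp (- \<i> * complex_of_real (\<xi> \<bullet> x)) * (cnj (?F \<xi>) * ?\<gamma> \<xi>)) =
          (LINT \<xi>|lborel. cnj (?F \<xi> * ?p \<xi>))"
        by (rule Bochner_Integration.integral_cong) (simp_all add: exp_cnj mult_ac)
      then show ?thesis unfolding fourier_integral_def[of _ x] by (simp only: Bochner_Integration.integral_cnj)
    qed
    also have "(LINT \<xi>|lborel. ?F \<xi> * ?p \<xi>) = (LINT y|lborel. h y * fourier_integral ?p y)"
      by (rule fourier_integral_multiplication[OF h1 ip])
    also have "\<dots> = (LINT y|lborel. h y * complex_of_real (sqrt (2 * pi) ^ CARD('n) / e ^ CARD('n) * gaussian ((y - x) /\<^sub>R e)))"
      by (simp only: Fp)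
    also have "\<dots> = (LINT y|lborel. h (y + x) * complex_of_real (sqrt (2 * pi) ^ CARD('n) / e ^ CARD('n) * gaussian (y /\<^sub>R e)))"
      using integral_translate[of "\<lambda>y. h y * complex_of_real (sqrt (2 * pi) ^ CARD('n) / e ^ CARD('n) * gaussian ((y - x) /\<^sub>R e))" x, symmetric]
      by simp
    also have "\<dots> = \<bar>e\<bar> ^ DIM(real^'n) *\<^sub>R (LINT z|lborel. h (e *\<^sub>R z + x) *
        complex_of_real (sqrt (2 * pi) ^ CARD('n) / e ^ CARD('n) * gaussian ((e *\<^sub>R z) /\<^sub>R e)))"
      by (rule integral_scale) (use e in auto)
    also have "(LINT z|lborel. h (e *\<^sub>R z + x) *
        complex_of_real (sqrt (2 * pi) ^ CARD('n) / e ^ CARD('n) * gaussian ((e *\<^sub>R z) /\<^sub>R e))) =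
      (LINT z|lborel. complex_of_real (sqrt (2 * pi) ^ CARD('n) / e ^ CARD('n)) * (h (x + e *\<^sub>R z) * complex_of_real (gaussian z)))"
      by (rule Bochner_Integration.integral_cong) (use e in \<open>auto simp: add.commute mult_ac\<close>)
    also have "\<bar>e\<bar> ^ DIM(real^'n) *\<^sub>R \<dots> = ?K * (LINT z|lborel. h (x + e *\<^sub>R z) * complex_of_real (gaussian z))"
      using e by (simp add: scaleR_conv_of_real)
    finally show ?thesis .
  qed
  \<comment> \<open>the elementary bound \<open>b c \<le> b\<^sup>2 + c\<^sup>2\<close> makes the double integral absolutely convergent\<close>
  let ?G = "\<lambda>(z::real^'n, x). complex_of_real (gaussian z) * (h x * cnj (h (x + e *\<^sub>R z)))"
  have "integrable (lborel \<Otimes>\<^sub>M lborel) ?G"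
  proof (rule lborel_pair.Fubini_integrable)
    show "?G \<in> borel_measurable (lborel \<Otimes>\<^sub>M lborel)" by measurable
    have iz: "integrable lborel (\<lambda>x. h x * cnj (h (x + e *\<^sub>R z)))" for z
      using L2_mult_integrable[OF h2 L2_cnj[OF L2_translate(1)[OF h2]]] .
    have le: "(LINT x|lborel. norm (?G (z, x))) \<le> 2 * (L2_norm h)\<^sup>2 * gaussian z" for z
    proof -
      have "(LINT x|lborel. cmod (h x * cnj (h (x + e *\<^sub>R z)))) \<le>
          (LINT x|lborel. (cmod (h x))\<^sup>2 + (cmod (h (x + e *\<^sub>R z)))\<^sup>2)"
      proof (rule integral_mono)
        show "integrable lborel (\<lambda>x. (cmod (h x))\<^sup>2 + (cmod (h (x + e *\<^sub>R z)))\<^sup>2)"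
          using L2_integrable[OF h2] L2_integrable[OF L2_translate(1)[OF h2, of "e *\<^sub>R z"]] by simp
        fix x
        show "cmod (h x * cnj (h (x + e *\<^sub>R z))) \<le> (cmod (h x))\<^sup>2 + (cmod (h (x + e *\<^sub>R z)))\<^sup>2"
          using sum_squares_bound[of "cmod (h x)" "cmod (h (x + e *\<^sub>R z))"]
            mult_nonneg_nonneg[OF norm_ge_zero[of "h x"] norm_ge_zero[of "h (x + e *\<^sub>R z)"]]
          unfolding norm_mult complex_mod_cnj by linarith
      qed (use iz in auto)
      also have "\<dots> = (L2_norm h)\<^sup>2 + (L2_norm (\<lambda>x. h (x + e *\<^sub>R z)))\<^sup>2"
        using L2_integrable[OF h2] L2_integrable[OF L2_translate(1)[OF h2, of "e *\<^sub>R z"]]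
        unfolding L2_norm_square by simp
      also have "\<dots> = 2 * (L2_norm h)\<^sup>2"
        unfolding L2_translate(2)[OF h2] by simp
      finally have *: "(LINT x|lborel. cmod (h x * cnj (h (x + e *\<^sub>R z)))) \<le> 2 * (L2_norm h)\<^sup>2" .
      have "(LINT x|lborel. norm (?G (z, x))) = gaussian z * (LINT x|lborel. cmod (h x * cnj (h (x + e *\<^sub>R z))))"
        by (simp add: norm_mult)
      also have "\<dots> \<le> gaussian z * (2 * (L2_norm h)\<^sup>2)"
        using * by (rule mult_left_mono) simp
      finally show ?thesis by (simp add: mult.commute)
    qed
    show "integrable lborel (\<lambda>z. LINT x|lborel. norm (?G (z, x)))"
    proof (rule Bochner_Integration.integrable_bound)
      show "integrable lborel (\<lambda>z::real^'n. 2 * (L2_norm h)\<^sup>2 * gaussian z)" by simp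
      show "(\<lambda>z. LINT x|lborel. norm (?G (z, x))) \<in> borel_measurable lborel" by measurable
      have "0 \<le> (LINT x|lborel. norm (?G (z, x)))" for z
        by (rule Bochner_Integration.integral_nonneg) simp
      then show "AE z in lborel. norm (LINT x|lborel. norm (?G (z, x))) \<le> norm (2 * (L2_norm h)\<^sup>2 * gaussian z)"
        using le by (intro AE_I2) (simp add: order_trans[OF le])
    qed
    show "AE z in lborel. integrable lborel (\<lambda>x. ?G (z, x))"
      using iz by simp
  qed
  from lborel_pair.Fubini_integral[OF this]
  have Fub: "(LINT x|lborel. LINT z|lborel. complex_of_real (gaussian z) * (h x * cnj (h (x + e *\<^sub>R z)))) =
      (LINT z|lborel. LINT x|lborel. complex_of_real (gaussian z) * (h x * cnj (h (x + e *\<^sub>R z))))"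
    by simp
  have "complex_of_real (LINT \<xi>|lborel. (cmod (?F \<xi>))\<^sup>2 * gaussian (e *\<^sub>R \<xi>)) =
      (LINT \<xi>|lborel. ?F \<xi> * (cnj (?F \<xi>) * ?\<gamma> \<xi>))"
    unfolding integral_complex_of_real[symmetric] sq[symmetric] by (simp only: mult.commute)
  also have "\<dots> = (LINT x|lborel. h x * fourier_integral (\<lambda>\<xi>. cnj (?F \<xi>) * ?\<gamma> \<xi>) x)"
    by (rule fourier_integral_multiplication[OF h1 iq])
  also have "\<dots> = (LINT x|lborel. ?K * (LINT z|lborel. complex_of_real (gaussian z) * (h x * cnj (h (x + e *\<^sub>R z)))))"
  proof (rule Bochner_Integration.integral_cong[OF refl])
    fix x
    have "h x * cnj (?K * (LINT z|lborel. h (x + e *\<^sub>R z) * complex_of_real (gaussian z))) =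
      ?K * (h x * (LINT z|lborel. cnj (h (x + e *\<^sub>R z) * complex_of_real (gaussian z))))"
      unfolding Bochner_Integration.integral_cnj
      by (simp only: complex_cnj_mult complex_cnj_complex_of_real mult_ac)
    also have "h x * (LINT z|lborel. cnj (h (x + e *\<^sub>R z) * complex_of_real (gaussian z))) =
       (LINT z|lborel. h x * cnj (h (x + e *\<^sub>R z) * complex_of_real (gaussian z)))"
      by (rule integral_mult_right_zero[symmetric])
    also have "\<dots> = (LINT z|lborel. complex_of_real (gaussian z) * (h x * cnj (h (x + e *\<^sub>R z))))"
      by (rule Bochner_Integration.integral_cong) (simp_all add: mult_ac)
    finally show "h x * fourier_integral (\<lambda>\<xi>. cnj (?F \<xi>) * ?\<gamma> \<xi>) x =
        ?K * (LINT z|lborel. complex_of_real (gaussian z) * (h x * cnj (h (x + e *\<^sub>R z))))"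
      unfolding Fq .
  qed
  also have "\<dots> = ?K * (LINT x|lborel. LINT z|lborel. complex_of_real (gaussian z) * (h x * cnj (h (x + e *\<^sub>R z))))"
    by (rule integral_mult_right_zero)
  also have "\<dots> = ?K * (LINT z|lborel. complex_of_real (gaussian z) * (LINT x|lborel. h x * cnj (h (x + e *\<^sub>R z))))"
    unfolding Fub by (simp only: integral_mult_right_zero)
  finally show ?E .
qed

text \<open>Let \<open>e\<close> decrease to \<open>0\<close> in \<open>gaussian_regularised_Plancherel\<close>. On the left the Gaussian increases
  to \<open>1\<close>, so monotone convergence yields integrability and the value of the integral at once; on
  the right the autocorrelation is bounded by its value at \<open>0\<close> and tends to it. One factor
  \<open>(2 pi)\<^sup>n\<^sup>/\<^sup>2\<close> comes from the transform of the Gaussian, the other one from its integral.\<close>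

theorem Plancherel_L1_L2:
  fixes h :: "real ^ 'n \<Rightarrow> complex"
  assumes h1: "integrable lborel h" and h2: "h \<in> L2_space"
  shows "fourier_integral h \<in> L2_space"
    and "(L2_norm (fourier_integral h))\<^sup>2 = (2 * pi) ^ CARD('n) * (L2_norm h)\<^sup>2"
proof -
  have [measurable]: "h \<in> borel_measurable borel" using h1 by auto
  define e where "e k = 1 / real (Suc k)" for k
  have e: "e k > 0" for k by (simp add: e_def)
  have e0: "e \<longlonglongrightarrow> 0" unfolding e_def using LIMSEQ_inverse_real_of_nat by (simp add: divide_inverse)
  let ?K = "sqrt (2 * pi) ^ CARD('n)"
  let ?f = "\<lambda>k \<xi>. (cmod (fourier_integral h \<xi>))\<^sup>2 * gaussian (e k *\<^sub>R \<xi>)"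
  let ?a = "\<lambda>k z. LINT x|lborel. h x * cnj (h (x + e k *\<^sub>R z))"
  have lim: "(\<lambda>k. LINT z|lborel. complex_of_real (gaussian z) * ?a k z) \<longlonglongrightarrow>
      (LINT z|lborel. complex_of_real (gaussian (z::real^'n)) * complex_of_real ((L2_norm h)\<^sup>2))"
  proof (rule integral_dominated_convergence[where w="\<lambda>z. (L2_norm h)\<^sup>2 * gaussian z"])
    show "AE z in lborel. (\<lambda>k. complex_of_real (gaussian z) * ?a k z) \<longlonglongrightarrow>
        complex_of_real (gaussian z) * complex_of_real ((L2_norm h)\<^sup>2)"
    proof (intro AE_I2 tendsto_mult tendsto_const autocorrelation_tendsto[OF h2])
      fix z :: "real ^ 'n"
      show "(\<lambda>k. e k *\<^sub>R z) \<longlonglongrightarrow> 0" using tendsto_scaleR[OF e0 tendsto_const[of z]] by simp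
    qed
    show "AE z in lborel. norm (complex_of_real (gaussian z) * ?a k z) \<le> (L2_norm h)\<^sup>2 * gaussian z" for k
    proof (rule AE_I2)
      fix z
      have "cmod (?a k z) \<le> (L2_norm h)\<^sup>2"
        using L2_Cauchy_Schwarz[OF h2 L2_cnj[OF L2_translate(1)[OF h2]], of "e k *\<^sub>R z"]
        unfolding L2_norm_cnj L2_translate(2)[OF h2] by (simp only: power2_eq_square)
      then show "norm (complex_of_real (gaussian z) * ?a k z) \<le> (L2_norm h)\<^sup>2 * gaussian z"
        by (simp add: norm_mult mult.commute mult_left_mono)
    qed
  qed auto
  have "(LINT z|lborel. complex_of_real (gaussian (z::real^'n)) * complex_of_real ((L2_norm h)\<^sup>2)) =
      complex_of_real (?K * (L2_norm h)\<^sup>2)"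
    by (simp only: integral_mult_left_zero integral_complex_of_real gaussian_integral of_real_mult) simp
  from tendsto_mult[OF tendsto_const[of "complex_of_real ?K"] lim[unfolded this]]
  have "(\<lambda>k. complex_of_real (LINT \<xi>|lborel. ?f k \<xi>)) \<longlonglongrightarrow> complex_of_real (?K * (?K * (L2_norm h)\<^sup>2))"
    by (simp only: gaussian_regularised_Plancherel(2)[OF h1 h2 e] of_real_mult)
  then have lim': "(\<lambda>k. LINT \<xi>|lborel. ?f k \<xi>) \<longlonglongrightarrow> ?K * (?K * (L2_norm h)\<^sup>2)"
    by (simp only: tendsto_of_real_iff)
  have mono: "AE \<xi> in lborel. mono (\<lambda>k. ?f k \<xi>)"
  proof (intro AE_I2 monoI mult_left_mono)
    fix \<xi> :: "real^'n" and j k :: nat assume "j \<le> k"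
    then have "e k \<le> e j" by (simp add: e_def frac_le)
    then have "(norm (e k *\<^sub>R \<xi>))\<^sup>2 \<le> (norm (e j *\<^sub>R \<xi>))\<^sup>2"
      using e[of k] by (intro power_mono) (auto intro: mult_right_mono)
    then show "gaussian (e j *\<^sub>R \<xi>) \<le> gaussian (e k *\<^sub>R \<xi>)" by (simp add: gaussian_def)
  qed auto
  have ptw: "AE \<xi> in lborel. (\<lambda>k. ?f k \<xi>) \<longlonglongrightarrow> (cmod (fourier_integral h \<xi>))\<^sup>2"
  proof (rule AE_I2)
    fix \<xi> :: "real^'n"
    have "(\<lambda>k. e k *\<^sub>R \<xi>) \<longlonglongrightarrow> 0" using tendsto_scaleR[OF e0 tendsto_const[of \<xi>]] by simp
    then have "(\<lambda>k. exp (- (norm (e k *\<^sub>R \<xi>))\<^sup>2 / 2)) \<longlonglongrightarrow> exp (- (norm (0::real^'n))\<^sup>2 / 2)"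
      by (intro tendsto_intros) auto
    then have "(\<lambda>k. gaussian (e k *\<^sub>R \<xi>)) \<longlonglongrightarrow> 1" by (simp add: gaussian_def)
    from tendsto_mult[OF tendsto_const[of "(cmod (fourier_integral h \<xi>))\<^sup>2"] this]
    show "(\<lambda>k. ?f k \<xi>) \<longlonglongrightarrow> (cmod (fourier_integral h \<xi>))\<^sup>2" by simp
  qed
  note conv = integral_monotone_convergence_nonneg[OF gaussian_regularised_Plancherel(1)[OF h1 h2 e] mono _ ptw lim']
  show "fourier_integral h \<in> L2_space"
    using conv(1) by (simp add: L2_space_def)
  have "?K * (?K * (L2_norm h)\<^sup>2) = (2 * pi) ^ CARD('n) * (L2_norm h)\<^sup>2"
    by (simp only: mult.assoc[symmetric] power_mult_distrib[symmetric] real_sqrt_mult_self) simp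
  then show "(L2_norm (fourier_integral h))\<^sup>2 = (2 * pi) ^ CARD('n) * (L2_norm h)\<^sup>2"
    using conv(2) by (simp add: L2_norm_square)
qed

section \<open>Completeness of the space of square integrable functions\<close>

lemma L2_norm_leI:
  assumes "(\<integral>\<^sup>+x. ennreal ((cmod (f x))\<^sup>2) \<partial>lborel) \<le> ennreal (c\<^sup>2)" "f \<in> borel_measurable borel" "0 \<le> c"
  shows "f \<in> L2_space" "L2_norm f \<le> c"
proof -
  have i: "integrable lborel (\<lambda>x. (cmod (f x))\<^sup>2)"
    by (rule integrableI_bounded) (use assms in \<open>auto simp: le_less_trans\<close>)
  with assms(2) show L2: "f \<in> L2_space" by (simp add: L2_space_def)
  then have "ennreal ((L2_norm f)\<^sup>2) \<le> ennreal (c\<^sup>2)"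
    using assms(1) by (simp add: nn_integral_L2)
  then have "(L2_norm f)\<^sup>2 \<le> c\<^sup>2" by (subst (asm) ennreal_le_iff) auto
  then show "L2_norm f \<le> c" using assms(3) by (rule power2_le_imp_le)
qed

text \<open>Fatou's lemma as lower semicontinuity of the norm under convergence almost everywhere. It also
  shows that the limit is square integrable, and this is how limits are recognised as elements
  of the space.\<close>

lemma L2_Fatou:
  fixes u :: "real ^ 'n \<Rightarrow> complex"
  assumes U: "\<And>j::nat. U j \<in> L2_space" and bound: "\<And>j. j \<ge> N \<Longrightarrow> L2_norm (U j) \<le> c"
    and lim: "AE x in lborel. (\<lambda>j. U j x) \<longlonglongrightarrow> u x" and [measurable]: "u \<in> borel_measurable borel"
  shows "u \<in> L2_space" "L2_norm u \<le> c"
proof -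
  have c: "0 \<le> c" using bound[of N] L2_norm_nonneg[of "U N"] by linarith
  have [measurable]: "U j \<in> borel_measurable borel" for j using U by (rule L2_measurable)
  have "(\<integral>\<^sup>+x. ennreal ((cmod (u x))\<^sup>2) \<partial>lborel) = (\<integral>\<^sup>+x. liminf (\<lambda>j. ennreal ((cmod (U j x))\<^sup>2)) \<partial>lborel)"
  proof (rule nn_integral_cong_AE)
    show "AE x in lborel. ennreal ((cmod (u x))\<^sup>2) = liminf (\<lambda>j. ennreal ((cmod (U j x))\<^sup>2))"
      using lim
    proof eventually_elim
      case (elim x)
      have "(\<lambda>j. ennreal ((cmod (U j x))\<^sup>2)) \<longlonglongrightarrow> ennreal ((cmod (u x))\<^sup>2)"
        by (intro tendsto_ennrealI tendsto_intros elim)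
      from lim_imp_Liminf[OF sequentially_bot this] show ?case by simp
    qed
  qed
  also have "\<dots> \<le> liminf (\<lambda>j. \<integral>\<^sup>+x. ennreal ((cmod (U j x))\<^sup>2) \<partial>lborel)"
    by (rule nn_integral_liminf) measurable
  also have "\<dots> \<le> ennreal (c\<^sup>2)"
  proof (rule Liminf_le)
    show "\<forall>\<^sub>F j in sequentially. (\<integral>\<^sup>+x. ennreal ((cmod (U j x))\<^sup>2) \<partial>lborel) \<le> ennreal (c\<^sup>2)"
      using eventually_ge_at_top[of N]
      by eventually_elim (auto simp: nn_integral_L2[OF U] intro!: ennreal_leI power_mono bound)
  qed simp
  finally show "u \<in> L2_space" "L2_norm u \<le> c"
    using c by (auto intro: L2_norm_leI)
qed

lemma L2_norm_minus_commute: "L2_norm (\<lambda>x. f x - g x) = L2_norm (\<lambda>x. g x - f x)"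
  by (simp add: L2_norm_def norm_minus_commute)

lemma L2_norm_triangle3:
  assumes "f \<in> L2_space" "g \<in> L2_space" "h \<in> L2_space"
  shows "L2_norm (\<lambda>x. f x - h x) \<le> L2_norm (\<lambda>x. f x - g x) + L2_norm (\<lambda>x. g x - h x)"
  using L2_norm_triangle[OF L2_diff[OF assms(1,2)] L2_diff[OF assms(2,3)]] by simp

text \<open>The weights \<open>2 ^ k\<close> in the series of the \<open>2 ^ k * |G (k + 1) - G k|\<^sup>2\<close> are small enough for its
  integral to be finite and large enough for its finiteness at a point to force geometric decay
  of \<open>G (k + 1) - G k\<close> there, with ratio \<open>1 / sqrt 2\<close>.\<close>

lemma L2_fast_Cauchy_pointwise:
  fixes G :: "nat \<Rightarrow> real ^ 'n \<Rightarrow> complex"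
  assumes G: "\<And>k. G k \<in> L2_space" and fast: "\<And>k. L2_norm (\<lambda>x. G (Suc k) x - G k x) \<le> B * (1/2) ^ k"
  shows "AE x in lborel. convergent (\<lambda>k. G k x)"
proof -
  let ?D = "\<lambda>k x. (cmod (G (Suc k) x - G k x))\<^sup>2"
  have [measurable]: "G k \<in> borel_measurable borel" for k using G by (rule L2_measurable)
  have "(\<integral>\<^sup>+x. (\<Sum>k. ennreal (2 ^ k * ?D k x)) \<partial>lborel) = (\<Sum>k. \<integral>\<^sup>+x. ennreal (2 ^ k * ?D k x) \<partial>lborel)"
    by (rule nn_integral_suminf) measurable
  also have "\<dots> \<le> (\<Sum>k. ennreal (B\<^sup>2 * (1/2) ^ k))"
  proof (rule suminf_le)
    fix k
    have "(\<integral>\<^sup>+x. ennreal (2 ^ k * ?D k x) \<partial>lborel) = ennreal (2 ^ k) * ennreal ((L2_norm (\<lambda>x. G (Suc k) x - G k x))\<^sup>2)"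
      by (simp add: ennreal_mult nn_integral_cmult nn_integral_L2[OF L2_diff[OF G G]])
    also have "\<dots> \<le> ennreal (2 ^ k) * ennreal ((B * (1/2) ^ k)\<^sup>2)"
      by (intro mult_left_mono ennreal_leI power_mono fast) auto
    also have "\<dots> = ennreal (2 ^ k * (B * (1/2) ^ k)\<^sup>2)"
      by (simp add: ennreal_mult)
    also have "2 ^ k * (B * (1/2) ^ k)\<^sup>2 = B\<^sup>2 * (1/2) ^ k"
      by (simp add: power_mult_distrib power2_eq_square power_divide)
    finally show "(\<integral>\<^sup>+x. ennreal (2 ^ k * ?D k x) \<partial>lborel) \<le> ennreal (B\<^sup>2 * (1/2) ^ k)" .
  qed auto
  also have "\<dots> = ennreal (\<Sum>k. B\<^sup>2 * (1/2) ^ k)"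
    by (rule suminf_ennreal2) (auto intro!: summable_mult summable_geometric)
  also have "\<dots> < \<infinity>" by simp
  finally have "AE x in lborel. (\<Sum>k. ennreal (2 ^ k * ?D k x)) \<noteq> \<infinity>"
    by (intro nn_integral_PInf_AE) auto
  then show ?thesis
  proof eventually_elim
    case (elim x)
    define F where "F k = ennreal (2 ^ k * ?D k x)" for k
    have "\<exists>C\<ge>0. S = ennreal C" if "S \<noteq> \<infinity>" for S :: ennreal
      using that by (cases S) auto
    from this[OF elim] obtain C where C: "C \<ge> 0" "suminf F = ennreal C"
      unfolding F_def by blast
    have le: "cmod (G (Suc k) x - G k x) \<le> sqrt C * (1 / sqrt 2) ^ k" for k
    proof (rule power2_le_imp_le)
      have "sum F {k} \<le> suminf F" by (rule sum_le_suminf) auto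
      then have "ennreal (2 ^ k * ?D k x) \<le> ennreal C" by (simp add: C(2) F_def)
      then have "2 ^ k * ?D k x \<le> C" using C(1) by (subst (asm) ennreal_le_iff) auto
      then have "?D k x \<le> C / 2 ^ k" by (simp add: field_simps)
      also have "C / 2 ^ k = C * ((1 / sqrt 2)\<^sup>2) ^ k" by (simp add: power_divide)
      also have "\<dots> = (sqrt C * (1 / sqrt 2) ^ k)\<^sup>2"
        using C(1) by (simp only: power_mult_distrib power_mult[symmetric] mult.commute[of k] real_sqrt_pow2)
      finally show "?D k x \<le> (sqrt C * (1 / sqrt 2) ^ k)\<^sup>2" .
    qed (use C in auto)
    have "norm (1 / sqrt 2) < (1::real)" by simp
    then have "summable (\<lambda>k. sqrt C * (1 / sqrt 2) ^ k)"
      by (intro summable_mult summable_geometric)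
    then have "summable (\<lambda>k. G (Suc k) x - G k x)"
      by (rule summable_comparison_test'[where N=0]) (rule le)
    then have "convergent (\<lambda>n. G 0 x + (\<Sum>k<n. G (Suc k) x - G k x))"
      unfolding summable_iff_convergent by (rule convergent_add[OF convergent_const])
    then show ?case by (simp add: sum_lessThan_telescope[of "\<lambda>k. G k x"])
  qed
qed

text \<open>The pointwise limit is also the limit in norm: apply \<open>L2_Fatou\<close> to \<open>G k - G (k + j)\<close> as
  \<open>j\<close> tends to infinity.\<close>

lemma L2_fast_Cauchy_limit:
  fixes G :: "nat \<Rightarrow> real ^ 'n \<Rightarrow> complex"
  assumes G: "\<And>k. G k \<in> L2_space" and fast: "\<And>k. L2_norm (\<lambda>x. G (Suc k) x - G k x) \<le> B * (1/2) ^ k"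
  shows "\<exists>g\<in>L2_space. (\<lambda>k. L2_norm (\<lambda>x. G k x - g x)) \<longlonglongrightarrow> 0"
proof -
  have [measurable]: "G k \<in> borel_measurable borel" for k using G by (rule L2_measurable)
  define g where "g x = lim (\<lambda>k. G k x)" for x
  have [measurable]: "g \<in> borel_measurable borel" unfolding g_def by measurable
  have lim: "AE x in lborel. (\<lambda>k. G k x) \<longlonglongrightarrow> g x"
    using L2_fast_Cauchy_pointwise[OF G fast]
    by eventually_elim (simp add: g_def convergent_LIMSEQ_iff)
  have tail: "L2_norm (\<lambda>x. G k x - G (k + m) x) \<le> 2 * B * (1/2) ^ k * (1 - (1/2) ^ m)" for k m
  proof (induction m)
    case (Suc m)
    have "L2_norm (\<lambda>x. G k x - G (k + Suc m) x) \<le>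
        L2_norm (\<lambda>x. G k x - G (k + m) x) + L2_norm (\<lambda>x. G (k + m) x - G (k + Suc m) x)"
      by (rule L2_norm_triangle3[OF G G G])
    also have "L2_norm (\<lambda>x. G (k + m) x - G (k + Suc m) x) \<le> B * (1/2) ^ (k + m)"
      using fast[of "k + m"] by (simp add: L2_norm_minus_commute[of "G (k + m)"])
    finally show ?case using Suc.IH by (simp add: power_add algebra_simps)
  qed (simp add: L2_norm_def)
  have B: "0 \<le> B" using order_trans[OF L2_norm_nonneg fast[of 0]] by simp
  have lim': "AE x in lborel. (\<lambda>j. G k x - G (k + j) x) \<longlonglongrightarrow> G k x - g x" for k
    using lim
  proof eventually_elim
    case (elim x)
    have "(\<lambda>j. G (j + k) x) \<longlonglongrightarrow> g x" using elim by (rule LIMSEQ_ignore_initial_segment)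
    then show ?case by (intro tendsto_intros) (simp add: add.commute)
  qed
  have tail': "L2_norm (\<lambda>x. G k x - G (k + m) x) \<le> 2 * B * (1/2) ^ k" for k m
  proof -
    have "2 * B * (1/2) ^ k * (1 - (1/2) ^ m) \<le> 2 * B * (1/2) ^ k * 1"
      using B by (intro mult_left_mono) auto
    with tail[of k m] show ?thesis by linarith
  qed
  have fat: "(\<lambda>x. G k x - g x) \<in> L2_space" "L2_norm (\<lambda>x. G k x - g x) \<le> 2 * B * (1/2) ^ k" for k
    by (rule L2_Fatou[where U="\<lambda>j x. G k x - G (k + j) x" and N=0];
        (rule L2_diff[OF G G] | rule tail' | rule lim' | measurable))+
  have "g \<in> L2_space" using L2_diff[OF G[of 0] fat(1)[of 0]] by simp
  moreover have "(\<lambda>k. L2_norm (\<lambda>x. G k x - g x)) \<longlonglongrightarrow> 0"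
  proof (rule Lim_null_comparison)
    show "(\<lambda>k. 2 * B * (1/2) ^ k) \<longlonglongrightarrow> 0"
      by (intro tendsto_mult_right_zero LIMSEQ_realpow_zero) auto
  qed (use fat in auto)
  ultimately show ?thesis by blast
qed

lemma L2_norm_tendsto:
  assumes "\<And>i. a i \<in> L2_space" "b \<in> L2_space" and lim: "((\<lambda>i. L2_norm (\<lambda>x. a i x - b x)) \<longlongrightarrow> 0) F"
  shows "((\<lambda>i. L2_norm (a i)) \<longlongrightarrow> L2_norm b) F"
proof (rule LIM_zero_cancel, rule Lim_null_comparison[OF _ lim])
  show "\<forall>\<^sub>F i in F. norm (L2_norm (a i) - L2_norm b) \<le> L2_norm (\<lambda>x. a i x - b x)"
    using L2_norm_diff_le[OF assms(1) assms(2)] by simp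
qed

lemma L2_pairing_tendsto:
  assumes a: "\<And>i. a i \<in> L2_space" "a' \<in> L2_space" "((\<lambda>i. L2_norm (\<lambda>x. a i x - a' x)) \<longlongrightarrow> 0) F"
    and b: "\<And>i. b i \<in> L2_space" "b' \<in> L2_space" "((\<lambda>i. L2_norm (\<lambda>x. b i x - b' x)) \<longlongrightarrow> 0) F"
  shows "((\<lambda>i. LINT x|lborel. a i x * b i x) \<longlongrightarrow> (LINT x|lborel. a' x * b' x)) F"
proof (rule LIM_zero_cancel, rule Lim_null_comparison)
  have "(LINT x|lborel. a i x * b i x) - (LINT x|lborel. a' x * b' x) =
      (LINT x|lborel. (a i x - a' x) * b i x) + (LINT x|lborel. a' x * (b i x - b' x))" for i
    using L2_mult_integrable[OF a(1)[of i] b(1)[of i]] L2_mult_integrable[OF a(2) b(1)[of i]]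
      L2_mult_integrable[OF a(2) b(2)]
    by (simp add: left_diff_distrib right_diff_distrib)
  then have "cmod ((LINT x|lborel. a i x * b i x) - (LINT x|lborel. a' x * b' x)) \<le>
      L2_norm (\<lambda>x. a i x - a' x) * L2_norm (b i) + L2_norm a' * L2_norm (\<lambda>x. b i x - b' x)" for i
    using L2_Cauchy_Schwarz[OF L2_diff[OF a(1)[of i] a(2)] b(1)[of i]]
      L2_Cauchy_Schwarz[OF a(2) L2_diff[OF b(1)[of i] b(2)]]
    by (metis (no_types, lifting) add_mono norm_triangle_le)
  then show "\<forall>\<^sub>F i in F. norm ((LINT x|lborel. a i x * b i x) - (LINT x|lborel. a' x * b' x)) \<le>
      L2_norm (\<lambda>x. a i x - a' x) * L2_norm (b i) + L2_norm a' * L2_norm (\<lambda>x. b i x - b' x)" by simp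
  have "((\<lambda>i. L2_norm (\<lambda>x. a i x - a' x) * L2_norm (b i) + L2_norm a' * L2_norm (\<lambda>x. b i x - b' x)) \<longlongrightarrow>
      0 * L2_norm b' + L2_norm a' * 0) F"
    by (rule tendsto_add[OF tendsto_mult[OF a(3) L2_norm_tendsto[OF b]] tendsto_mult[OF tendsto_const b(3)]])
  then show "((\<lambda>i. L2_norm (\<lambda>x. a i x - a' x) * L2_norm (b i) + L2_norm a' * L2_norm (\<lambda>x. b i x - b' x)) \<longlongrightarrow> 0) F"
    by simp
qed

section \<open>The Fourier--Plancherel transform\<close>

abbreviation trunc :: "real \<Rightarrow> (real ^ 'n \<Rightarrow> complex) \<Rightarrow> real ^ 'n \<Rightarrow> complex" where
  "trunc R f \<equiv> (\<lambda>x. indicator (cball 0 R) x * f x)"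

text \<open>The factor by which the unnormalised transform multiplies the norm; the argument only carries
  the dimension.\<close>

abbreviation fourier_const :: "'n itself \<Rightarrow> real" where
  "fourier_const _ \<equiv> sqrt (2 * pi) ^ CARD('n)"

lemma trunc_L2: "f \<in> L2_space \<Longrightarrow> trunc R f \<in> L2_space"
  by (rule L2_indicator) auto

lemma trunc_integrable:
  fixes f :: "real ^ 'n \<Rightarrow> complex"
  assumes "f \<in> L2_space"
  shows "integrable lborel (trunc R f)"
proof -
  have "integrable lborel (indicator (cball 0 R) :: real ^ 'n \<Rightarrow> real)"
    using emeasure_lborel_cball_finite by (intro integrable_real_indicator) auto
  moreover have "(\<lambda>x. (cmod (indicator (cball 0 R) x))\<^sup>2) = (indicator (cball 0 R) :: real ^ 'n \<Rightarrow> real)"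
    by (auto simp: indicator_def)
  ultimately have "(indicator (cball 0 R) :: real ^ 'n \<Rightarrow> complex) \<in> L2_space"
    by (simp add: L2_space_def borel_measurable_indicator)
  then show ?thesis using assms by (rule L2_mult_integrable)
qed

lemma trunc_tendsto:
  fixes f :: "real ^ 'n \<Rightarrow> complex"
  assumes f: "f \<in> L2_space"
  shows "((\<lambda>R. L2_norm (\<lambda>x. trunc R f x - f x)) \<longlongrightarrow> 0) at_top"
proof -
  have [measurable]: "f \<in> borel_measurable borel" using f by (rule L2_measurable)
  have "((\<lambda>R. LINT x|lborel. (cmod (trunc R f x - f x))\<^sup>2) \<longlongrightarrow> (LINT x|(lborel :: (real^'n) measure). 0)) at_top"
  proof (rule integral_dominated_convergence_at_top[where w="\<lambda>x. (cmod (f x))\<^sup>2"])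
    show "AE x in lborel. ((\<lambda>R. (cmod (trunc R f x - f x))\<^sup>2) \<longlongrightarrow> 0) at_top"
    proof (rule AE_I2)
      fix x
      have "\<forall>\<^sub>F R in at_top. (cmod (trunc R f x - f x))\<^sup>2 = 0"
        using eventually_ge_at_top[of "norm x"] by eventually_elim (auto simp: indicator_def)
      then show "((\<lambda>R. (cmod (trunc R f x - f x))\<^sup>2) \<longlongrightarrow> 0) at_top"
        by (rule tendsto_eventually)
    qed
  qed (use L2_integrable[OF f] in \<open>auto simp: indicator_def\<close>)
  then have "((\<lambda>R. sqrt (LINT x|lborel. (cmod (trunc R f x - f x))\<^sup>2)) \<longlongrightarrow> sqrt 0) at_top"
    by (intro tendsto_real_sqrt) simp
  then show ?thesis by (simp add: L2_norm_def)
qed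

lemma fourier_trunc_L2: "f \<in> L2_space \<Longrightarrow> fourier_integral (trunc R f) \<in> L2_space"
  by (rule Plancherel_L1_L2(1)) (auto intro: trunc_integrable trunc_L2)

lemma Plancherel_norm_L1_L2:
  fixes h :: "real ^ 'n \<Rightarrow> complex"
  assumes "integrable lborel h" "h \<in> L2_space"
  shows "L2_norm (fourier_integral h) = fourier_const TYPE('n) * L2_norm h"
proof -
  have "(L2_norm (fourier_integral h))\<^sup>2 = (fourier_const TYPE('n) * L2_norm h)\<^sup>2"
    using Plancherel_L1_L2(2)[OF assms]
    by (simp add: power_mult_distrib power_mult[symmetric] mult.commute[of _ 2] power_mult[of _ 2])
  then show ?thesis by (simp add: power2_eq_iff_nonneg)
qed

lemma Plancherel_norm_diff:
  fixes h k :: "real ^ 'n \<Rightarrow> complex"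
  assumes "integrable lborel h" "h \<in> L2_space" "integrable lborel k" "k \<in> L2_space"
  shows "L2_norm (\<lambda>\<xi>. fourier_integral h \<xi> - fourier_integral k \<xi>) =
    fourier_const TYPE('n) * L2_norm (\<lambda>x. h x - k x)"
proof -
  have "(\<lambda>\<xi>. fourier_integral h \<xi> - fourier_integral k \<xi>) = fourier_integral (\<lambda>x. h x - k x)"
    using fourier_integral_diff[OF assms(1,3)] by auto
  then show ?thesis
    using Plancherel_norm_L1_L2[OF Bochner_Integration.integrable_diff[OF assms(1,3)] L2_diff[OF assms(2,4)]]
    by simp
qed

text \<open>On square integrable functions the extended integral in the definition is a squared norm, so
  that from here on only limits of norms have to be handled.\<close>

lemma has_fourier_iff:
  "has_fourier f g \<longleftrightarrow> f \<in> L2_space \<and> g \<in> L2_space \<and>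
    ((\<lambda>R. L2_norm (\<lambda>\<xi>. fourier_integral (trunc R f) \<xi> - g \<xi>)) \<longlongrightarrow> 0) at_top"
proof (cases "f \<in> L2_space \<and> g \<in> L2_space")
  case True
  let ?N = "\<lambda>R. L2_norm (\<lambda>\<xi>. fourier_integral (trunc R f) \<xi> - g \<xi>)"
  have "(\<integral>\<^sup>+\<xi>. ennreal ((cmod (fourier_integral (trunc R f) \<xi> - g \<xi>))\<^sup>2) \<partial>lborel) = ennreal ((?N R)\<^sup>2)" for R
    by (rule nn_integral_L2) (use True in \<open>auto intro!: L2_diff fourier_trunc_L2\<close>)
  then have "has_fourier f g \<longleftrightarrow> ((\<lambda>R. ennreal ((?N R)\<^sup>2)) \<longlongrightarrow> ennreal 0) at_top"
    using True by (simp add: has_fourier_def)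
  also have "\<dots> \<longleftrightarrow> ((\<lambda>R. (?N R)\<^sup>2) \<longlongrightarrow> 0) at_top"
    by (rule tendsto_ennreal_iff) auto
  also have "\<dots> \<longleftrightarrow> (?N \<longlongrightarrow> 0) at_top"
  proof
    assume "((\<lambda>R. (?N R)\<^sup>2) \<longlongrightarrow> 0) at_top"
    from tendsto_real_sqrt[OF this] show "(?N \<longlongrightarrow> 0) at_top" by simp
  next
    assume "(?N \<longlongrightarrow> 0) at_top"
    from tendsto_power[OF this, of 2] show "((\<lambda>R. (?N R)\<^sup>2) \<longlongrightarrow> 0) at_top" by simp
  qed
  finally show ?thesis using True by simp
qed (auto simp: has_fourier_def)

lemma has_fourier_L2: "has_fourier f g \<Longrightarrow> f \<in> L2_space" "has_fourier f g \<Longrightarrow> g \<in> L2_space"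
  by (simp_all add: has_fourier_def)

text \<open>By the isometry on integrable functions the transforms of the truncations form a Cauchy family
  as the radius grows. Completeness is applied to a sequence of radii \<open>\<rho> k\<close> with geometrically
  small tails, and the Cauchy estimate extends the convergence to all radii.\<close>

theorem has_fourier_exists:
  fixes f :: "real ^ 'n \<Rightarrow> complex"
  assumes f: "f \<in> L2_space"
  shows "\<exists>g. has_fourier f g"
proof -
  let ?K = "fourier_const TYPE('n)"
  let ?t = "\<lambda>R. L2_norm (\<lambda>x. trunc R f x - f x)"
  let ?F = "\<lambda>R. fourier_integral (trunc R f)"
  have FL2: "?F R \<in> L2_space" for R using f by (rule fourier_trunc_L2)
  have cauchy: "L2_norm (\<lambda>\<xi>. ?F R \<xi> - ?F S \<xi>) \<le> ?K * (?t R + ?t S)" for R S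
  proof -
    have "L2_norm (\<lambda>x. trunc R f x - trunc S f x) \<le> ?t R + L2_norm (\<lambda>x. f x - trunc S f x)"
      using L2_norm_triangle3[OF trunc_L2[OF f] f trunc_L2[OF f]] .
    also have "L2_norm (\<lambda>x. f x - trunc S f x) = ?t S" by (rule L2_norm_minus_commute)
    finally show ?thesis
      unfolding Plancherel_norm_diff[OF trunc_integrable[OF f] trunc_L2[OF f] trunc_integrable[OF f] trunc_L2[OF f]]
      by (rule mult_left_mono) simp
  qed
  have "\<exists>R. ?t R < (1/2) ^ k" for k :: nat
  proof -
    have "\<forall>\<^sub>F R in at_top. ?t R < (1/2) ^ k"
      by (rule order_tendstoD(2)[OF trunc_tendsto[OF f]]) simp
    then show ?thesis by (rule eventually_happens'[OF trivial_limit_at_top_linorder])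
  qed
  then obtain \<rho> where \<rho>: "\<And>k::nat. ?t (\<rho> k) < (1/2) ^ k" by metis
  have "L2_norm (\<lambda>\<xi>. ?F (\<rho> (Suc k)) \<xi> - ?F (\<rho> k) \<xi>) \<le> (2 * ?K) * (1/2) ^ k" for k
  proof -
    have "?t (\<rho> (Suc k)) + ?t (\<rho> k) \<le> (1/2) ^ k + (1/2) ^ k"
    proof (rule add_mono)
      have "?t (\<rho> (Suc k)) \<le> (1/2) ^ Suc k" using \<rho> by (rule less_imp_le)
      also have "\<dots> \<le> (1/2) ^ k" by simp
      finally show "?t (\<rho> (Suc k)) \<le> (1/2) ^ k" .
      show "?t (\<rho> k) \<le> (1/2) ^ k" using \<rho> by (rule less_imp_le)
    qed
    then have "?K * (?t (\<rho> (Suc k)) + ?t (\<rho> k)) \<le> ?K * ((1/2) ^ k + (1/2) ^ k)"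
      by (rule mult_left_mono) simp
    also have "?K * ((1/2) ^ k + (1/2) ^ k) = (2 * ?K) * (1/2) ^ k"
      by (simp add: algebra_simps)
    finally show ?thesis by (rule order_trans[OF cauchy])
  qed
  then obtain g where g: "g \<in> L2_space" and lim: "(\<lambda>k. L2_norm (\<lambda>\<xi>. ?F (\<rho> k) \<xi> - g \<xi>)) \<longlonglongrightarrow> 0"
    using L2_fast_Cauchy_limit[of "\<lambda>k. ?F (\<rho> k)" "2 * ?K"] FL2 by blast
  have \<rho>0: "(\<lambda>k. ?t (\<rho> k)) \<longlonglongrightarrow> 0"
  proof (rule Lim_null_comparison)
    show "\<forall>\<^sub>F k in sequentially. norm (?t (\<rho> k)) \<le> (1/2) ^ k"
      using less_imp_le[OF \<rho>] by (intro always_eventually allI) simp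
    show "(\<lambda>k. (1/2::real) ^ k) \<longlonglongrightarrow> 0" by (rule LIMSEQ_realpow_zero) auto
  qed
  \<comment> \<open>compare with the radius \<open>\<rho> k\<close> and let \<open>k\<close> tend to infinity\<close>
  have le: "L2_norm (\<lambda>\<xi>. ?F R \<xi> - g \<xi>) \<le> ?K * ?t R" for R
  proof (rule tendsto_lowerbound)
    show "(\<lambda>k. ?K * (?t R + ?t (\<rho> k)) + L2_norm (\<lambda>\<xi>. ?F (\<rho> k) \<xi> - g \<xi>)) \<longlonglongrightarrow> ?K * ?t R"
      by (rule tendsto_eq_rhs[OF tendsto_add[OF tendsto_mult[OF tendsto_const tendsto_add[OF tendsto_const \<rho>0]] lim]]) simp
    show "\<forall>\<^sub>F k in sequentially. L2_norm (\<lambda>\<xi>. ?F R \<xi> - g \<xi>) \<le>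
        ?K * (?t R + ?t (\<rho> k)) + L2_norm (\<lambda>\<xi>. ?F (\<rho> k) \<xi> - g \<xi>)"
      using order_trans[OF L2_norm_triangle3[OF FL2 FL2 g] add_right_mono[OF cauchy]] by simp
  qed simp
  have "((\<lambda>R. L2_norm (\<lambda>\<xi>. ?F R \<xi> - g \<xi>)) \<longlongrightarrow> 0) at_top"
  proof (rule Lim_null_comparison)
    show "((\<lambda>R. ?K * ?t R) \<longlongrightarrow> 0) at_top"
      using tendsto_mult_right_zero[OF trunc_tendsto[OF f]] .
    show "\<forall>\<^sub>F R in at_top. norm (L2_norm (\<lambda>\<xi>. ?F R \<xi> - g \<xi>)) \<le> ?K * ?t R"
      using le by simp
  qed
  then have "has_fourier f g" using f g by (simp add: has_fourier_iff)
  then show ?thesis by blast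
qed

theorem Plancherel:
  fixes f :: "real ^ 'n \<Rightarrow> complex"
  assumes "has_fourier f g"
  shows "L2_norm g = fourier_const TYPE('n) * L2_norm f"
proof -
  have f: "f \<in> L2_space" and g: "g \<in> L2_space"
    and lim: "((\<lambda>R. L2_norm (\<lambda>\<xi>. fourier_integral (trunc R f) \<xi> - g \<xi>)) \<longlongrightarrow> 0) at_top"
    using assms by (auto simp: has_fourier_iff)
  have "((\<lambda>R. L2_norm (fourier_integral (trunc R f))) \<longlongrightarrow> L2_norm g) at_top"
    by (rule L2_norm_tendsto[OF fourier_trunc_L2[OF f] g lim])
  moreover have "((\<lambda>R. L2_norm (fourier_integral (trunc R f))) \<longlongrightarrow> fourier_const TYPE('n) * L2_norm f) at_top"
    unfolding Plancherel_norm_L1_L2[OF trunc_integrable[OF f] trunc_L2[OF f]]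
    by (rule tendsto_mult[OF tendsto_const L2_norm_tendsto[OF trunc_L2[OF f] f trunc_tendsto[OF f]]])
  ultimately show ?thesis by (rule tendsto_unique[OF trivial_limit_at_top_linorder]) 
qed

lemma has_fourier_diff:
  fixes f f' :: "real ^ 'n \<Rightarrow> complex"
  assumes fg: "has_fourier f g" and fg': "has_fourier f' g'"
  shows "has_fourier (\<lambda>x. f x - f' x) (\<lambda>\<xi>. g \<xi> - g' \<xi>)"
proof -
  note L2 = has_fourier_L2[OF fg] has_fourier_L2[OF fg']
  let ?F = "\<lambda>R f. fourier_integral (trunc R f)"
  have eq: "?F R (\<lambda>x. f x - f' x) \<xi> = ?F R f \<xi> - ?F R f' \<xi>" for R \<xi>
    using fourier_integral_diff[OF trunc_integrable[OF L2(1)] trunc_integrable[OF L2(3)]]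
    by (simp add: right_diff_distrib)
  have le: "L2_norm (\<lambda>\<xi>. ?F R (\<lambda>x. f x - f' x) \<xi> - (g \<xi> - g' \<xi>)) \<le>
      L2_norm (\<lambda>\<xi>. ?F R f \<xi> - g \<xi>) + L2_norm (\<lambda>\<xi>. ?F R f' \<xi> - g' \<xi>)" for R
  proof -
    have "L2_norm (\<lambda>\<xi>. ?F R (\<lambda>x. f x - f' x) \<xi> - (g \<xi> - g' \<xi>)) =
        L2_norm (\<lambda>\<xi>. (?F R f \<xi> - g \<xi>) + - (?F R f' \<xi> - g' \<xi>))"
      unfolding eq by (simp add: algebra_simps)
    also have "\<dots> \<le> L2_norm (\<lambda>\<xi>. ?F R f \<xi> - g \<xi>) + L2_norm (\<lambda>\<xi>. - (?F R f' \<xi> - g' \<xi>))"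
      by (rule L2_norm_triangle; intro L2_uminus L2_diff fourier_trunc_L2 L2)
    finally show ?thesis unfolding L2_norm_uminus .
  qed
  have "((\<lambda>R. L2_norm (\<lambda>\<xi>. ?F R f \<xi> - g \<xi>) + L2_norm (\<lambda>\<xi>. ?F R f' \<xi> - g' \<xi>)) \<longlongrightarrow> 0) at_top"
    using fg fg' by (auto simp: has_fourier_iff intro: tendsto_add_zero)
  then have "((\<lambda>R. L2_norm (\<lambda>\<xi>. ?F R (\<lambda>x. f x - f' x) \<xi> - (g \<xi> - g' \<xi>))) \<longlongrightarrow> 0) at_top"
    by (rule Lim_null_comparison[rotated]) (use le in simp)
  then show ?thesis using L2_diff[OF L2(1,3)] L2_diff[OF L2(2,4)] by (simp add: has_fourier_iff)
qed

lemma has_fourier_AE_cong: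
  assumes fg: "has_fourier f g" and eq: "AE \<xi> in lborel. g \<xi> = g' \<xi>" and g': "g' \<in> L2_space"
  shows "has_fourier f g'"
proof -
  have f: "f \<in> L2_space" and g: "g \<in> L2_space" using fg by (rule has_fourier_L2)+
  have "L2_norm (\<lambda>\<xi>. fourier_integral (trunc R f) \<xi> - g \<xi>) = L2_norm (\<lambda>\<xi>. fourier_integral (trunc R f) \<xi> - g' \<xi>)" for R
  proof (rule L2_norm_cong_AE)
    show "AE \<xi> in lborel. fourier_integral (trunc R f) \<xi> - g \<xi> = fourier_integral (trunc R f) \<xi> - g' \<xi>"
      using eq by eventually_elim simp
  qed (intro L2_measurable L2_diff fourier_trunc_L2 f g g')+
  then show ?thesis using fg g' by (simp add: has_fourier_iff)
qed

lemma has_fourier_unique: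
  assumes "has_fourier f g" "has_fourier f g'"
  shows "AE \<xi> in lborel. g \<xi> = g' \<xi>"
proof -
  have d: "has_fourier (\<lambda>x. f x - f x) (\<lambda>\<xi>. g \<xi> - g' \<xi>)" by (rule has_fourier_diff[OF assms])
  have "L2_norm (\<lambda>\<xi>. g \<xi> - g' \<xi>) = 0" using Plancherel[OF d] by (simp add: L2_norm_def)
  from L2_norm_eq_0_AE[OF has_fourier_L2(2)[OF d] this] show ?thesis by simp
qed

text \<open>The multiplication formula holds for the truncations, and the bilinear pairing is continuous in
  both arguments.\<close>

theorem has_fourier_multiplication:
  fixes f k :: "real ^ 'n \<Rightarrow> complex"
  assumes "has_fourier f g" "has_fourier k l"
  shows "(LINT x|lborel. g x * k x) = (LINT x|lborel. f x * l x)"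
proof -
  have L2: "f \<in> L2_space" "g \<in> L2_space" "k \<in> L2_space" "l \<in> L2_space"
    and lim: "((\<lambda>R. L2_norm (\<lambda>\<xi>. fourier_integral (trunc R f) \<xi> - g \<xi>)) \<longlongrightarrow> 0) at_top"
      "((\<lambda>R. L2_norm (\<lambda>\<xi>. fourier_integral (trunc R k) \<xi> - l \<xi>)) \<longlongrightarrow> 0) at_top"
    using assms by (auto simp: has_fourier_iff)
  have eq: "(LINT x|lborel. fourier_integral (trunc R f) x * trunc R k x) =
      (LINT x|lborel. trunc R f x * fourier_integral (trunc R k) x)" for R
    by (rule fourier_integral_multiplication; intro trunc_integrable L2)
  have "((\<lambda>R. LINT x|lborel. fourier_integral (trunc R f) x * trunc R k x) \<longlongrightarrow> (LINT x|lborel. g x * k x)) at_top"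
    by (rule L2_pairing_tendsto[OF fourier_trunc_L2[OF L2(1)] L2(2) lim(1) trunc_L2[OF L2(3)] L2(3) trunc_tendsto[OF L2(3)]])
  moreover have "((\<lambda>R. LINT x|lborel. trunc R f x * fourier_integral (trunc R k) x) \<longlongrightarrow> (LINT x|lborel. f x * l x)) at_top"
    by (rule L2_pairing_tendsto[OF trunc_L2[OF L2(1)] L2(1) trunc_tendsto[OF L2(1)] fourier_trunc_L2[OF L2(3)] L2(4) lim(2)])
  ultimately show ?thesis unfolding eq by (rule tendsto_unique[OF trivial_limit_at_top_linorder])
qed

text \<open>Let \<open>K\<close> be the constant of the isometry and \<open>p\<close> the transform of the conjugate of \<open>g\<close>. The
  candidate is the conjugate of \<open>p\<close> divided by \<open>K\<^sup>2\<close>. Its transform \<open>g'\<close> has the norm of \<open>g\<close>, by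
  applying the isometry twice, and the multiplication formula turns the inner product of \<open>g'\<close> and
  \<open>g\<close> into the pairing of \<open>f\<close> and \<open>p\<close>, which is again the squared norm of \<open>g\<close>. Expanding
  the squared norm of \<open>g' - g\<close> therefore gives \<open>0\<close>.\<close>

theorem has_fourier_surjective:
  fixes g :: "real ^ 'n \<Rightarrow> complex"
  assumes g: "g \<in> L2_space"
  shows "\<exists>f. has_fourier f g"
proof -
  let ?K = "fourier_const TYPE('n)"
  have K: "?K > 0" by simp
  obtain p where p: "has_fourier (\<lambda>x. cnj (g x)) p"
    using has_fourier_exists[OF L2_cnj[OF g]] by blast
  define f where "f x = complex_of_real (1 / ?K\<^sup>2) * cnj (p x)" for x
  have f: "f \<in> L2_space"
    unfolding f_def by (rule L2_scale[OF L2_cnj[OF has_fourier_L2(2)[OF p]]])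
  obtain g' where g': "has_fourier f g'" using has_fourier_exists[OF f] by blast
  have np: "L2_norm p = ?K * L2_norm g" using Plancherel[OF p] by simp
  have "L2_norm f = 1 / ?K\<^sup>2 * L2_norm p"
    unfolding f_def L2_norm_scale L2_norm_cnj using K by (simp add: norm_divide norm_power)
  then have ng': "L2_norm g' = L2_norm g"
    using Plancherel[OF g'] np K by (simp add: power2_eq_square)
  have "(LINT x|lborel. g' x * cnj (g x)) = (LINT x|lborel. f x * p x)"
    by (rule has_fourier_multiplication[OF g' p])
  also have "\<dots> = (LINT x|lborel. complex_of_real (1 / ?K\<^sup>2) * (p x * cnj (p x)))"
    by (simp add: f_def mult_ac)
  also have "\<dots> = complex_of_real (1 / ?K\<^sup>2) * complex_of_real ((L2_norm p)\<^sup>2)"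
    unfolding L2_inner_self[symmetric] by (rule integral_mult_right_zero)
  also have "\<dots> = complex_of_real ((L2_norm g)\<^sup>2)"
    using K by (simp add: np power_mult_distrib)
  finally have inner: "(LINT x|lborel. g' x * cnj (g x)) = complex_of_real ((L2_norm g)\<^sup>2)" .
  have "(L2_norm (\<lambda>x. g' x + - g x))\<^sup>2 =
      (L2_norm g')\<^sup>2 + (L2_norm (\<lambda>x. - g x))\<^sup>2 + 2 * Re (LINT x|lborel. g' x * cnj (- g x))"
    by (rule L2_norm_add_square[OF has_fourier_L2(2)[OF g'] L2_uminus[OF g]])
  also have "(LINT x|lborel. g' x * cnj (- g x)) = - complex_of_real ((L2_norm g)\<^sup>2)"
    using inner by simp
  finally have "L2_norm (\<lambda>x. g' x - g x) = 0"
    unfolding L2_norm_uminus ng' by simp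
  from L2_norm_eq_0_AE[OF L2_diff[OF has_fourier_L2(2)[OF g'] g] this]
  have "AE x in lborel. g' x = g x" by simp
  from has_fourier_AE_cong[OF g' this g] show ?thesis by blast
qed

lemma has_fourier_fourier: "f \<in> L2_space \<Longrightarrow> has_fourier f (fourier f)"
  unfolding fourier_def by (rule someI_ex[of "has_fourier f"]) (rule has_fourier_exists)

lemma has_fourier_inverse_fourier: "g \<in> L2_space \<Longrightarrow> has_fourier (inverse_fourier g) g"
  unfolding inverse_fourier_def by (rule someI_ex[of "\<lambda>f. has_fourier f g"]) (rule has_fourier_surjective)

text \<open>Where the Fourier integral converges absolutely it may replace the chosen transform. Only this
  gives access to pointwise bounds on the transforms of the initial data.\<close>

lemma fourier_eq_fourier_integral:
  fixes f :: "real ^ 'n \<Rightarrow> complex"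
  assumes f1: "integrable lborel f" and f2: "f \<in> L2_space"
  shows "AE \<xi> in lborel. fourier f \<xi> = fourier_integral f \<xi>"
proof (rule has_fourier_unique[OF has_fourier_fourier[OF f2]])
  have "((\<lambda>R. L2_norm (\<lambda>\<xi>. fourier_integral (trunc R f) \<xi> - fourier_integral f \<xi>)) \<longlongrightarrow> 0) at_top"
    unfolding Plancherel_norm_diff[OF trunc_integrable[OF f2] trunc_L2[OF f2] f1 f2]
    by (rule tendsto_mult_right_zero[OF trunc_tendsto[OF f2]])
  then show "has_fourier f (fourier_integral f)"
    using f2 Plancherel_L1_L2(1)[OF f1 f2] by (simp add: has_fourier_iff)
qed

text \<open>The bridge between the two sides: a distance to an inverse transform is measured in
  frequency space.\<close>

theorem L2_norm_diff_inverse_fourier: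
  fixes u g :: "real ^ 'n \<Rightarrow> complex"
  assumes "u \<in> L2_space" "g \<in> L2_space"
  shows "L2_norm (\<lambda>\<xi>. fourier u \<xi> - g \<xi>) =
    fourier_const TYPE('n) * L2_norm (\<lambda>x. u x - inverse_fourier g x)"
  by (rule Plancherel[OF has_fourier_diff[OF has_fourier_fourier has_fourier_inverse_fourier]]) fact+

section \<open>The oscillator at a fixed frequency\<close>

text \<open>With the equation factored by its characteristic roots \<open>\<nu>\<close> and \<open>\<nu>'\<close>, the combination
  \<open>w' - \<nu> w\<close> satisfies a first-order equation with rate \<open>\<nu>'\<close>.\<close>

lemma damped_oscillator_factor:
  fixes w w' w'' :: "real \<Rightarrow> complex"
  assumes w: "\<And>s. s \<ge> 0 \<Longrightarrow> (w has_vector_derivative w' s) (at s within {0..})"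
    and w': "\<And>s. s \<ge> 0 \<Longrightarrow> (w' has_vector_derivative w'' s) (at s within {0..})"
    and ode: "\<And>s. s \<ge> 0 \<Longrightarrow> w'' s - (\<nu> + \<nu>') * w' s + \<nu> * \<nu>' * w s = 0"
    and t: "t \<ge> 0"
  shows "w' t - \<nu> * w t = exp (complex_of_real t * \<nu>') * (w' 0 - \<nu> * w 0)"
proof -
  let ?q = "\<lambda>s. exp (s *\<^sub>R (- \<nu>')) * (w' s - \<nu> * w s)"
  have "(?q has_vector_derivative 0) (at s within {0..})" if "s \<in> {0..}" for s
  proof -
    have s: "s \<ge> 0" using that by simp
    have "((\<lambda>s. w' s - \<nu> * w s) has_vector_derivative (w'' s - \<nu> * w' s)) (at s within {0..})"
      by (intro has_vector_derivative_diff has_vector_derivative_mult_right w w' s)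
    from has_vector_derivative_mult[OF exp_scaleR_has_vector_derivative_right this, of "- \<nu>'"]
    have "(?q has_vector_derivative exp (s *\<^sub>R (- \<nu>')) * (w'' s - \<nu> * w' s) +
        exp (s *\<^sub>R (- \<nu>')) * (- \<nu>') * (w' s - \<nu> * w s)) (at s within {0..})" .
    moreover have "exp (s *\<^sub>R (- \<nu>')) * (w'' s - \<nu> * w' s) +
        exp (s *\<^sub>R (- \<nu>')) * (- \<nu>') * (w' s - \<nu> * w s) =
        exp (s *\<^sub>R (- \<nu>')) * (w'' s - (\<nu> + \<nu>') * w' s + \<nu> * \<nu>' * w s)"
      by (simp add: algebra_simps)
    ultimately show ?thesis using ode[OF s] by simp
  qed
  then obtain c where c: "\<And>s. s \<in> {0..} \<Longrightarrow> ?q s = c"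
    using has_vector_derivative_zero_constant[of "{0..}" ?q] by auto
  have "?q t = ?q 0" using c[of t] c[of 0] t by simp
  then have "exp (complex_of_real t * \<nu>') * ?q t = exp (complex_of_real t * \<nu>') * (w' 0 - \<nu> * w 0)" by simp
  moreover have "exp (complex_of_real t * \<nu>') * ?q t = w' t - \<nu> * w t"
    by (simp add: scaleR_conv_of_real exp_minus)
  ultimately show ?thesis by simp
qed

text \<open>Use the factorisation with the roots \<open>- a \<plusminus> \<i> \<omega>\<close> in both orders; subtracting the two identities
  eliminates \<open>w'\<close>, and the difference of the roots is nonzero because \<open>\<omega> \<noteq> 0\<close>.\<close>

lemma damped_oscillator_solution:
  fixes w w' w'' :: "real \<Rightarrow> complex" and a \<omega> :: real
  assumes w: "\<And>s. s \<ge> 0 \<Longrightarrow> (w has_vector_derivative w' s) (at s within {0..})"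
    and w': "\<And>s. s \<ge> 0 \<Longrightarrow> (w' has_vector_derivative w'' s) (at s within {0..})"
    and ode: "\<And>s. s \<ge> 0 \<Longrightarrow> w'' s + complex_of_real (2 * a) * w' s + complex_of_real (a\<^sup>2 + \<omega>\<^sup>2) * w s = 0"
    and t: "t \<ge> 0" and \<omega>: "\<omega> \<noteq> 0"
  shows "w t = complex_of_real (exp (- a * t)) *
    (complex_of_real (cos (\<omega> * t)) * w 0 + complex_of_real (sin (\<omega> * t) / \<omega>) * (w' 0 + complex_of_real a * w 0))"
proof -
  let ?p = "Complex (- a) \<omega>" and ?m = "Complex (- a) (- \<omega>)"
  have sum: "?p + ?m = - complex_of_real (2 * a)" "?m + ?p = - complex_of_real (2 * a)"
    by (simp_all add: complex_eq_iff)
  have prod: "?p * ?m = complex_of_real (a\<^sup>2 + \<omega>\<^sup>2)" "?m * ?p = complex_of_real (a\<^sup>2 + \<omega>\<^sup>2)"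
    by (simp_all add: complex_eq_iff power2_eq_square)
  have A: "w' t - ?p * w t = exp (complex_of_real t * ?m) * (w' 0 - ?p * w 0)"
    by (rule damped_oscillator_factor[OF w w' _ t]) (simp_all add: sum prod ode del: of_real_mult of_real_add)
  have B: "w' t - ?m * w t = exp (complex_of_real t * ?p) * (w' 0 - ?m * w 0)"
    by (rule damped_oscillator_factor[OF w w' _ t]) (simp_all add: sum prod ode del: of_real_mult of_real_add)
  have ep: "exp (complex_of_real t * ?p) = complex_of_real (exp (- a * t)) * (complex_of_real (cos (\<omega> * t)) + \<i> * complex_of_real (sin (\<omega> * t)))"
    and em: "exp (complex_of_real t * ?m) = complex_of_real (exp (- a * t)) * (complex_of_real (cos (\<omega> * t)) - \<i> * complex_of_real (sin (\<omega> * t)))"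
    by (simp_all add: complex_eq_iff Re_exp Im_exp mult.commute)
  have pm: "?p = - complex_of_real a + \<i> * complex_of_real \<omega>" "?m = - complex_of_real a - \<i> * complex_of_real \<omega>"
    by (simp_all add: complex_eq_iff)
  have "2 * \<i> * complex_of_real \<omega> * w t = (w' t - ?m * w t) - (w' t - ?p * w t)"
    unfolding pm by (simp add: algebra_simps)
  also have "\<dots> = 2 * \<i> * complex_of_real \<omega> * (complex_of_real (exp (- a * t)) *
    (complex_of_real (cos (\<omega> * t)) * w 0 + complex_of_real (sin (\<omega> * t) / \<omega>) * (w' 0 + complex_of_real a * w 0)))"
  proof -
    have "(E * (c + \<i> * s)) * (W - (- A - \<i> * \<theta>) * V) - (E * (c - \<i> * s)) * (W - (- A + \<i> * \<theta>) * V) =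
        2 * \<i> * \<theta> * (E * (c * V + (s / \<theta>) * (W + A * V)))" if "\<theta> \<noteq> 0" for E c s W A \<theta> V :: complex
      using that by (simp add: field_simps)
    from this[of "complex_of_real \<omega>"] show ?thesis
      unfolding A B unfolding ep em unfolding pm using \<omega> by (simp only: of_real_eq_0_iff of_real_divide not_False_eq_True simp_thms)
  qed
  finally show ?thesis using \<omega> by simp
qed

lemma abs_sin_diff_le: "\<bar>sin x - sin y\<bar> \<le> \<bar>x - y :: real\<bar>"
proof -
  have "\<bar>sin x - sin y\<bar> = 2 * \<bar>sin ((x - y) / 2)\<bar> * \<bar>cos ((x + y) / 2)\<bar>"
    by (simp add: sin_diff_sin abs_mult)
  also have "\<dots> \<le> 2 * \<bar>(x - y) / 2\<bar> * 1"
    by (intro mult_mono abs_sin_x_le_abs_x) auto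
  finally show ?thesis by simp
qed

text \<open>Second order expansion of the logarithm for \<open>r \<le> 1\<close>; for larger \<open>r\<close> the left-hand side is below
  \<open>1\<close>.\<close>

lemma one_minus_log_ratio_le:
  fixes r :: real
  assumes "r > 0"
  shows "1 - ln (1 + r) / r \<le> r"
proof (cases "r \<le> 1")
  case True
  have "r - r\<^sup>2 \<le> ln (1 + r)" using assms True by (intro ln_one_plus_pos_lower_bound) auto
  then show ?thesis using assms by (simp add: field_simps power2_eq_square)
next
  case False
  have "0 \<le> ln (1 + r) / r" using assms by simp
  then show ?thesis using False by linarith
qed

text \<open>With \<open>l = log(1 + r) / r \<in> [0, 1]\<close> the frequency is \<open>r q / 2\<close> with \<open>q\<^sup>2 = 4 - \<mu>\<^sup>2 l\<^sup>2 \<ge> \<kappa>\<^sup>2\<close>. The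
  distance to \<open>r \<kappa> / 2\<close> is quadratic in \<open>r\<close> because
  \<open>(q - \<kappa>) \<kappa> \<le> q\<^sup>2 - \<kappa>\<^sup>2 = \<mu>\<^sup>2 (1 - l\<^sup>2) = O(r)\<close>.\<close>

lemma frequency_estimates:
  fixes \<mu> r :: real
  assumes \<mu>: "0 < \<mu>" "\<mu> < 2" and r: "r > 0"
  defines "\<kappa> \<equiv> sqrt (4 - \<mu>\<^sup>2)" and "\<omega> \<equiv> r * sqrt (4 - (\<mu> * ln (1 + r) / r)\<^sup>2) / 2"
  shows "\<kappa> > 0" "r * \<kappa> / 2 \<le> \<omega>" "\<bar>\<omega> - r * \<kappa> / 2\<bar> \<le> 4 * r\<^sup>2 / \<kappa>"
    "\<omega>\<^sup>2 = r\<^sup>2 - (\<mu> * ln (1 + r) / 2)\<^sup>2"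
proof -
  define l where "l = ln (1 + r) / r"
  define q where "q = sqrt (4 - (\<mu> * l)\<^sup>2)"
  have \<omega>: "\<omega> = r * q / 2" by (simp add: \<omega>_def q_def l_def)
  have l: "0 \<le> l" "l \<le> 1" "1 - l \<le> r"
    using r ln_add_one_self_le_self[of r] one_minus_log_ratio_le[OF r] by (simp_all add: l_def)
  have \<mu>2: "\<mu>\<^sup>2 < 4" using \<mu> power_strict_mono[of \<mu> 2 2] by simp
  then show \<kappa>: "\<kappa> > 0" by (simp add: \<kappa>_def)
  have l2: "l\<^sup>2 \<le> 1" using l by (simp add: power_le_one)
  have m2: "(\<mu> * l)\<^sup>2 \<le> \<mu>\<^sup>2" using l2 by (simp add: power_mult_distrib mult_left_le)
  have q\<kappa>: "\<kappa> \<le> q" using m2 by (simp add: \<kappa>_def q_def)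
  have q2: "q\<^sup>2 = 4 - (\<mu> * l)\<^sup>2" and \<kappa>2: "\<kappa>\<^sup>2 = 4 - \<mu>\<^sup>2"
    using m2 \<mu>2 by (simp_all add: q_def \<kappa>_def)
  show "r * \<kappa> / 2 \<le> \<omega>" using q\<kappa> r by (simp add: \<omega>)
  show "\<omega>\<^sup>2 = r\<^sup>2 - (\<mu> * ln (1 + r) / 2)\<^sup>2"
    unfolding \<omega> power_mult_distrib power_divide q2 using r by (simp add: l_def field_simps power2_eq_square)
  have "(q - \<kappa>) * \<kappa> \<le> (q - \<kappa>) * (q + \<kappa>)"
    using q\<kappa> \<kappa> by (intro mult_left_mono) auto
  also have "\<dots> = q\<^sup>2 - \<kappa>\<^sup>2" by (simp add: power2_eq_square algebra_simps)
  also have "\<dots> = \<mu>\<^sup>2 * (1 - l\<^sup>2)" unfolding q2 \<kappa>2 by (simp add: power_mult_distrib algebra_simps)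
  also have "\<dots> \<le> 4 * (2 * r)"
  proof (rule mult_mono)
    have "1 - l\<^sup>2 = (1 - l) * (1 + l)" by (simp add: power2_eq_square algebra_simps)
    also have "\<dots> \<le> r * 2" using l r by (intro mult_mono) auto
    finally show "1 - l\<^sup>2 \<le> 2 * r" by simp
  qed (use \<mu>2 l2 in auto)
  finally have "q - \<kappa> \<le> 8 * r / \<kappa>" using \<kappa> by (simp add: pos_le_divide_eq)
  then have s1: "r / 2 * (q - \<kappa>) \<le> r / 2 * (8 * r / \<kappa>)" using r by (intro mult_left_mono) auto
  have s2: "\<bar>\<omega> - r * \<kappa> / 2\<bar> = r / 2 * (q - \<kappa>)"
    using q\<kappa> r by (simp add: \<omega> algebra_simps mult_left_mono)
  have s3: "r / 2 * (8 * r / \<kappa>) = 4 * r\<^sup>2 / \<kappa>" by (simp add: power2_eq_square)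
  show "\<bar>\<omega> - r * \<kappa> / 2\<bar> \<le> 4 * r\<^sup>2 / \<kappa>"
    using s1 by (simp only: s2 s3)
qed

text \<open>The inequality \<open>|exp (- \<i> \<theta>) - 1| \<le> |\<theta>|\<close> trades one power of \<open>\<xi>\<close> for the first moment of \<open>u\<close>.\<close>

lemma fourier_integral_minus_mean:
  fixes u :: "real ^ 'n \<Rightarrow> complex"
  assumes u: "u \<in> L11_space"
  shows "cmod (fourier_integral u \<xi> - (LINT x|lborel. u x)) \<le> norm \<xi> * L11_norm u"
proof -
  have u1: "integrable lborel u" and u2: "integrable lborel (\<lambda>x. (1 + norm x) * cmod (u x))"
    using u by (auto simp: L11_space_def L1_space_def)
  note Fi = fourier_integrand_integrable[OF u1, of \<xi>]
  have "fourier_integral u \<xi> - (LINT x|lborel. u x) =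
      (LINT x|lborel. exp (- \<i> * complex_of_real (x \<bullet> \<xi>)) * u x - u x)"
    unfolding fourier_integral_def using Fi u1 by (rule Bochner_Integration.integral_diff[symmetric])
  also have "cmod \<dots> \<le> (LINT x|lborel. cmod (exp (- \<i> * complex_of_real (x \<bullet> \<xi>)) * u x - u x))"
    by (rule integral_norm_bound)
  also have "\<dots> \<le> (LINT x|lborel. norm \<xi> * ((1 + norm x) * cmod (u x)))"
  proof (rule integral_mono)
    fix x :: "real ^ 'n"
    have "cmod (exp (- \<i> * complex_of_real (x \<bullet> \<xi>)) - 1) \<le> \<bar>x \<bullet> \<xi>\<bar>"
      using iexp_approx1[of "- (x \<bullet> \<xi>)" 0] by simp
    also have "\<dots> \<le> norm \<xi> * (1 + norm x)"
      using Cauchy_Schwarz_ineq2[of x \<xi>] norm_ge_zero[of \<xi>] unfolding distrib_left mult.commute[of "norm x"] by linarith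
    finally have "cmod (exp (- \<i> * complex_of_real (x \<bullet> \<xi>)) - 1) * cmod (u x) \<le> norm \<xi> * (1 + norm x) * cmod (u x)"
      by (rule mult_right_mono) simp
    then show "cmod (exp (- \<i> * complex_of_real (x \<bullet> \<xi>)) * u x - u x) \<le> norm \<xi> * ((1 + norm x) * cmod (u x))"
      by (simp add: norm_mult[symmetric] left_diff_distrib mult.assoc)
  qed (use Fi u1 u2 in auto)
  also have "\<dots> = norm \<xi> * L11_norm u"
    unfolding L11_norm_def by (rule integral_mult_right_zero)
  finally show ?thesis .
qed

lemma mean_le_L11_norm:
  fixes u :: "real ^ 'n \<Rightarrow> complex"
  assumes u: "u \<in> L11_space"
  shows "cmod (LINT x|lborel. u x) \<le> L11_norm u"
proof -
  have u1: "integrable lborel u" and u2: "integrable lborel (\<lambda>x. (1 + norm x) * cmod (u x))"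
    using u by (auto simp: L11_space_def L1_space_def)
  have "cmod (LINT x|lborel. u x) \<le> (LINT x|lborel. cmod (u x))" by (rule integral_norm_bound)
  also have "\<dots> \<le> L11_norm u"
    unfolding L11_norm_def by (rule integral_mono) (use u1 u2 in \<open>auto simp: mult_le_cancel_right1\<close>)
  finally show ?thesis .
qed

section \<open>Integrability of the majorant\<close>

text \<open>The difference of the two sides vanishes at \<open>0\<close> and has the derivative
  \<open>s ((1 + x)\<^sup>s\<^sup>-\<^sup>1 - 1) \<ge> 0\<close>.\<close>

lemma powr_Bernoulli:
  fixes x s :: real
  assumes "x \<ge> 0" "s \<ge> 1"
  shows "1 + s * x \<le> (1 + x) powr s"
proof -
  let ?f = "\<lambda>x. (1 + x) powr s - s * x"
  have "?f 0 \<le> ?f x"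
  proof (rule DERIV_nonneg_imp_nondecreasing[OF assms(1)])
    fix y :: real assume y: "0 \<le> y" "y \<le> x"
    have "(?f has_real_derivative s * (1 + y) powr (s - 1) - s) (at y)"
      using y by (auto intro!: derivative_eq_intros)
    moreover have "s * (1 + y) powr (s - 1) - s \<ge> 0"
      using y assms(2) ge_one_powr_ge_zero[of "1 + y" "s - 1"] by simp
    ultimately show "\<exists>d. (?f has_real_derivative d) (at y) \<and> d \<ge> 0" by blast
  qed
  then show ?thesis by simp
qed

lemma integrable_inverse_one_plus_square: "integrable lborel (\<lambda>x::real. 1 / (1 + x\<^sup>2))"
  using integrable_inverse_1_plus_square
  by (simp add: set_integrable_def einterval_def inverse_eq_divide)

text \<open>Each of the \<open>n\<close> factors \<open>(1 + norm x)\<^sup>2\<close> dominates \<open>1 + x\<^sub>b\<^sup>2\<close> for one coordinate \<open>b\<close>, so the function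
  lies below a product of integrable functions of one variable.\<close>

lemma integrable_norm_decay:
  "integrable lborel (\<lambda>x::'a::euclidean_space. 1 / (1 + norm x) ^ (2 * DIM('a)))"
proof (rule Bochner_Integration.integrable_bound)
  show "integrable lborel (\<lambda>x::'a. \<Prod>b\<in>Basis. 1 / (1 + (x \<bullet> b)\<^sup>2))"
    by (rule integrable_prod_Basis[where f="\<lambda>_ t. 1 / (1 + t\<^sup>2)"]) (rule integrable_inverse_one_plus_square)
  have "1 / (1 + norm x) ^ (2 * DIM('a)) \<le> (\<Prod>b\<in>Basis. 1 / (1 + (x \<bullet> b)\<^sup>2))" for x :: 'a
  proof -
    have "1 / (1 + norm x) ^ (2 * DIM('a)) = (\<Prod>b\<in>(Basis::'a set). 1 / (1 + norm x)\<^sup>2)"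
      by (simp add: power_mult power_divide)
    also have "\<dots> \<le> (\<Prod>b\<in>Basis. 1 / (1 + (x \<bullet> b)\<^sup>2))"
    proof (rule prod_mono, intro conjI)
      fix b :: 'a assume b: "b \<in> Basis"
      have "(x \<bullet> b)\<^sup>2 \<le> (norm x)\<^sup>2"
        using Basis_le_norm[OF b, of x] by (metis abs_le_square_iff abs_norm_cancel)
      then have "1 + (x \<bullet> b)\<^sup>2 \<le> (1 + norm x)\<^sup>2"
        using norm_ge_zero[of x] unfolding power2_sum one_power2 by linarith
      then show "1 / (1 + norm x)\<^sup>2 \<le> 1 / (1 + (x \<bullet> b)\<^sup>2)"
        by (intro divide_left_mono mult_pos_pos zero_less_power) (auto simp: add_pos_nonneg)
    qed simp
    finally show ?thesis .
  qed
  then show "AE x::'a in lborel. norm (1 / (1 + norm x) ^ (2 * DIM('a))) \<le> norm (\<Prod>b\<in>Basis. 1 / (1 + (x \<bullet> b)\<^sup>2))"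
    by (intro AE_I2) (simp add: prod_nonneg)
qed simp

text \<open>The square of the majorant \<open>(1 + r t) (1 + r)\<^sup>-\<^sup>t\<^sup>\<mu>\<^sup>/\<^sup>2\<close> of the error at frequency \<open>\<xi>\<close>.\<close>

definition decay_weight :: "real \<Rightarrow> real \<Rightarrow> 'a::euclidean_space \<Rightarrow> real" where
  "decay_weight \<mu> t \<xi> = (1 + norm \<xi> * t)\<^sup>2 * (1 + norm \<xi>) powr (- (t * \<mu>))"

lemma decay_weight_measurable [measurable]: "decay_weight \<mu> t \<in> borel_measurable borel"
  unfolding decay_weight_def by measurable

lemma decay_weight_nonneg: "0 \<le> decay_weight \<mu> t \<xi>"
  by (simp add: decay_weight_def)

text \<open>Substitute \<open>\<xi> = \<eta> / t\<close>, which produces the factor \<open>t\<^sup>-\<^sup>n\<close>. Since \<open>(1 + \<rho> / t)\<^sup>t\<close> increases with \<open>t\<close>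
  by Bernoulli's inequality, the rescaled weight is for all \<open>t \<ge> T\<close> at most its analogue \<open>H\<close> for
  \<open>t = T\<close>, which decays polynomially with a power that grows with \<open>T\<close>.\<close>

lemma decay_weight_integral_bound:
  assumes \<mu>: "\<mu> > 0"
  shows "\<exists>C>0. \<exists>T>0. \<forall>t\<ge>T. integrable lborel (decay_weight \<mu> t :: 'a::euclidean_space \<Rightarrow> real) \<and>
    (LINT \<xi>|lborel. decay_weight \<mu> t (\<xi>::'a)) \<le> C * t powr (- real DIM('a))"
proof -
  let ?n = "DIM('a)"
  \<comment> \<open>the exponent \<open>T \<mu> \<ge> 2 n + 2\<close> pays for the factor \<open>(1 + \<rho>)\<^sup>2\<close> and leaves the integrable decay
    of order \<open>2 n\<close>\<close>
  define T where "T = max 1 ((2 * real ?n + 2) / \<mu>)"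
  have T: "T \<ge> 1" "T > 0" by (auto simp: T_def)
  have T\<mu>: "2 * real ?n + 2 \<le> T * \<mu>"
  proof -
    have "(2 * real ?n + 2) / \<mu> \<le> T" by (simp add: T_def)
    then show ?thesis using \<mu> by (simp add: pos_divide_le_eq)
  qed
  define H where "H \<eta> = (1 + norm \<eta>)\<^sup>2 * (1 + norm \<eta> / T) powr (- (T * \<mu>))" for \<eta> :: 'a
  have [measurable]: "H \<in> borel_measurable borel" unfolding H_def by measurable
  have H0: "0 \<le> H \<eta>" for \<eta> by (simp add: H_def)
  have iH: "integrable lborel H"
  proof (rule Bochner_Integration.integrable_bound)
    show "integrable lborel (\<lambda>\<eta>::'a. T powr (T * \<mu>) * (1 / (1 + norm \<eta>) ^ (2 * ?n)))"
      by (intro integrable_mult_right integrable_norm_decay)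
    have "H \<eta> \<le> T powr (T * \<mu>) * (1 / (1 + norm \<eta>) ^ (2 * ?n))" for \<eta>
    proof -
      let ?s = "1 + norm \<eta>"
      have s: "?s \<ge> 1" "?s > 0" by (auto simp: add_pos_nonneg)
      have "?s / T \<le> 1 + norm \<eta> / T" using T by (simp add: add_divide_distrib)
      then have "(1 + norm \<eta> / T) powr (- (T * \<mu>)) \<le> (?s / T) powr (- (T * \<mu>))"
        using T s \<mu> by (intro powr_mono2') auto
      also have "\<dots> = T powr (T * \<mu>) * ?s powr (- (T * \<mu>))"
        using T s by (simp add: powr_divide powr_minus field_simps)
      also have "\<dots> \<le> T powr (T * \<mu>) * ?s powr (- (2 * real ?n + 2))"
        using T\<mu> s by (intro mult_left_mono powr_mono) auto
      also have "?s powr (- (2 * real ?n + 2)) = 1 / ?s ^ (2 * ?n + 2)"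
      proof -
        have "?s powr (2 * real ?n + 2) = ?s powr real (2 * ?n + 2)" by (simp add: add.commute)
        also have "\<dots> = ?s ^ (2 * ?n + 2)" using s by (intro powr_realpow)
        finally show ?thesis by (simp only: powr_minus inverse_eq_divide)
      qed
      finally have "H \<eta> \<le> ?s\<^sup>2 * (T powr (T * \<mu>) * (1 / ?s ^ (2 * ?n + 2)))"
        unfolding H_def by (intro mult_left_mono) auto
      also have "\<dots> = T powr (T * \<mu>) * (1 / ?s ^ (2 * ?n))"
      proof -
        have "p * (c * (1 / (q * p))) = c * (1 / q)" if "p \<noteq> 0" for p q c :: real
          using that by simp
        then show ?thesis unfolding power_add using s by simp
      qed
      finally show ?thesis .
    qed
    then show "AE \<eta> in lborel. norm (H \<eta>) \<le> norm (T powr (T * \<mu>) * (1 / (1 + norm \<eta>) ^ (2 * ?n)))"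
      using H0 by (intro AE_I2) (simp only: real_norm_def, rule order_trans[OF _ abs_ge_self], simp)
  qed simp
  have main: "integrable lborel (decay_weight \<mu> t :: 'a \<Rightarrow> real) \<and>
      (LINT \<xi>|lborel. decay_weight \<mu> t (\<xi>::'a)) \<le> (LINT \<eta>|lborel. H \<eta>) * t powr (- real ?n)"
    if t: "t \<ge> T" for t
  proof -
    have t0: "t > 0" using t T by linarith
    have le: "decay_weight \<mu> t \<xi> \<le> H (t *\<^sub>R \<xi>)" for \<xi> :: 'a
    proof -
      let ?r = "norm \<xi>"
      have "1 + t / T * ?r \<le> (1 + ?r) powr (t / T)"
        using t T by (intro powr_Bernoulli) auto
      then have "((1 + ?r) powr (t / T)) powr (- (T * \<mu>)) \<le> (1 + t / T * ?r) powr (- (T * \<mu>))"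
        using T t0 \<mu> by (intro powr_mono2') (auto simp: add_pos_nonneg)
      also have "((1 + ?r) powr (t / T)) powr (- (T * \<mu>)) = (1 + ?r) powr (- (t * \<mu>))"
        using T by (simp add: powr_powr)
      also have "1 + t / T * ?r = 1 + norm (t *\<^sub>R \<xi>) / T" using t0 by simp
      finally have "(1 + ?r * t)\<^sup>2 * (1 + ?r) powr (- (t * \<mu>)) \<le>
          (1 + ?r * t)\<^sup>2 * (1 + norm (t *\<^sub>R \<xi>) / T) powr (- (T * \<mu>))"
        by (rule mult_left_mono) simp
      moreover have "?r * t = norm (t *\<^sub>R \<xi>)" using t0 by simp
      ultimately show ?thesis unfolding decay_weight_def H_def by (simp only:)
    qed
    have iHt: "integrable lborel (\<lambda>\<xi>::'a. H (t *\<^sub>R \<xi>))"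
      using iH t0 by (simp add: integrable_scale)
    have iW: "integrable lborel (decay_weight \<mu> t :: 'a \<Rightarrow> real)"
    proof (rule Bochner_Integration.integrable_bound[OF iHt])
      show "AE \<xi>::'a in lborel. norm (decay_weight \<mu> t \<xi>) \<le> norm (H (t *\<^sub>R \<xi>))"
        by (intro AE_I2) (simp only: real_norm_def abs_of_nonneg[OF decay_weight_nonneg] abs_of_nonneg[OF H0] le)
    qed simp
    have "(LINT \<xi>|lborel. decay_weight \<mu> t (\<xi>::'a)) \<le> (LINT \<xi>|lborel. H (t *\<^sub>R \<xi>))"
      by (rule integral_mono[OF iW iHt le])
    also have "\<dots> = (LINT \<eta>|lborel. H \<eta>) * t powr (- real ?n)"
      using integral_scale[of H t] t0 by (simp add: powr_minus powr_realpow field_simps)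
    finally show ?thesis using iW by blast
  qed
  define C where "C = (LINT \<eta>|lborel. H \<eta>) + 1"
  have "0 \<le> (LINT \<eta>|lborel. H \<eta>)" using H0 by (intro Bochner_Integration.integral_nonneg)
  then have C: "C > 0" by (simp add: C_def)
  have "integrable lborel (decay_weight \<mu> t :: 'a \<Rightarrow> real) \<and>
      (LINT \<xi>|lborel. decay_weight \<mu> t (\<xi>::'a)) \<le> C * t powr (- real ?n)" if t: "t \<ge> T" for t
  proof -
    have "(LINT \<eta>|lborel. H \<eta>) * t powr (- real ?n) \<le> C * t powr (- real ?n)"
      unfolding C_def by (intro mult_right_mono) auto
    then show ?thesis using main[OF t] by linarith
  qed
  then show ?thesis using C T(2) by blast
qed

section \<open>Comparison with the profile\<close>

lemma powr_half_square: "(x powr (- (y / 2)))\<^sup>2 = x powr (- y :: real)"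
  unfolding power2_eq_square powr_add[symmetric] by simp

text \<open>Writes the amplitude of the profile as \<open>1 / \<omega>\<close>, with \<open>\<omega>\<close> as in \<open>frequency_estimates\<close>.\<close>

lemma profile_eq:
  "profile \<mu> P t \<xi> = complex_of_real ((1 + norm \<xi>) powr (- (t * \<mu> / 2)) *
    (1 / (norm \<xi> * sqrt (4 - (\<mu> * ln (1 + norm \<xi>) / norm \<xi>)\<^sup>2) / 2)) *
    sin (norm \<xi> * sqrt (4 - \<mu>\<^sup>2) / 2 * t)) * P"
  by (simp add: profile_def Let_def)

lemma profile_measurable [measurable]:
  "profile \<mu> P t \<in> borel_measurable (borel :: (real ^ 'n) measure)"
  unfolding profile_def Let_def by measurable

text \<open>The singular amplitude \<open>1 / \<omega>\<close> is cancelled by \<open>|sin (r \<kappa> t / 2)| \<le> r \<kappa> t / 2 \<le> \<omega> t\<close>. The bound grows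
  with \<open>t\<close> and only serves to place the profile in \<open>L\<^sup>2\<close>.\<close>

lemma profile_square_bound:
  fixes \<xi> :: "real ^ 'n"
  assumes \<mu>: "0 < \<mu>" "\<mu> < 2" and t: "t \<ge> 0"
  shows "(cmod (profile \<mu> P t \<xi>))\<^sup>2 \<le> (t * cmod P)\<^sup>2 * decay_weight \<mu> t \<xi>"
proof (cases "\<xi> = 0")
  case True
  then show ?thesis by (simp add: profile_def decay_weight_def)
next
  case False
  define r where "r = norm \<xi>"
  have r: "r > 0" using False by (simp add: r_def)
  define \<kappa> where "\<kappa> = sqrt (4 - \<mu>\<^sup>2)"
  define \<omega> where "\<omega> = r * sqrt (4 - (\<mu> * ln (1 + r) / r)\<^sup>2) / 2"
  define E where "E = (1 + r) powr (- (t * \<mu> / 2))"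
  note fr = frequency_estimates[OF \<mu> r, folded \<kappa>_def \<omega>_def]
  have \<omega>: "\<omega> > 0" using fr(1,2) r by (smt (verit) divide_pos_pos mult_pos_pos)
  have E: "E \<ge> 0" "E\<^sup>2 = (1 + r) powr (- (t * \<mu>))"
    by (simp_all only: E_def powr_ge_zero powr_half_square)
  have "\<bar>sin (r * \<kappa> / 2 * t)\<bar> \<le> \<bar>r * \<kappa> / 2 * t\<bar>" by (rule abs_sin_x_le_abs_x)
  also have "\<dots> = r * \<kappa> / 2 * t" using r fr(1) t by (simp add: abs_mult)
  also have "\<dots> \<le> \<omega> * t" using fr(2) t by (rule mult_right_mono)
  finally have "1 / \<omega> * \<bar>sin (r * \<kappa> / 2 * t)\<bar> \<le> t"
    using \<omega> by (simp add: field_simps)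
  then have "E * (1 / \<omega> * \<bar>sin (r * \<kappa> / 2 * t)\<bar>) * cmod P \<le> E * t * cmod P"
    using E by (intro mult_right_mono mult_left_mono) auto
  moreover have "cmod (profile \<mu> P t \<xi>) = E * (1 / \<omega> * \<bar>sin (r * \<kappa> / 2 * t)\<bar>) * cmod P"
    unfolding profile_eq norm_mult norm_of_real
    using \<omega> E unfolding r_def[symmetric] \<kappa>_def[symmetric] \<omega>_def[symmetric] E_def[symmetric]
    by (simp add: abs_mult)
  ultimately have "cmod (profile \<mu> P t \<xi>) \<le> E * t * cmod P" by simp
  then have "(cmod (profile \<mu> P t \<xi>))\<^sup>2 \<le> (E * t * cmod P)\<^sup>2" by (rule power_mono) simp
  also have "\<dots> = (t * cmod P)\<^sup>2 * (1 * E\<^sup>2)" by (simp add: power_mult_distrib)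
  also have "\<dots> \<le> (t * cmod P)\<^sup>2 * decay_weight \<mu> t \<xi>"
    unfolding decay_weight_def r_def[symmetric] E(2)[symmetric]
    using r t by (intro mult_left_mono mult_right_mono one_le_power) auto
  finally show ?thesis .
qed

text \<open>With \<open>1 / \<omega> \<le> 2 / (r \<kappa>)\<close>, the terms with \<open>w 0\<close> contribute \<open>(1 + 2 / \<kappa>) N\<close>, the deviation of \<open>w' 0\<close>
  from \<open>P\<close> contributes \<open>2 M / \<kappa>\<close>, and the shift of the frequency in the sine contributes
  \<open>8 r t M / \<kappa>\<^sup>2\<close>, all to be multiplied by the damping factor. The constant in the statement
  absorbs these contributions into a single product.\<close>

lemma solution_minus_profile_bound:
  fixes \<xi> :: "real ^ 'n"
  assumes \<mu>: "0 < \<mu>" "\<mu> < 2" and t: "t \<ge> 0" and \<xi>: "\<xi> \<noteq> 0"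
    and w: "\<And>s. s \<ge> 0 \<Longrightarrow> (w has_vector_derivative w' s) (at s within {0..})"
    and w': "\<And>s. s \<ge> 0 \<Longrightarrow> (w' has_vector_derivative w'' s) (at s within {0..})"
    and ode: "\<And>s. s \<ge> 0 \<Longrightarrow> w'' s + complex_of_real (\<mu> * L_symbol \<xi>) * w' s + complex_of_real ((norm \<xi>)\<^sup>2) * w s = 0"
    and N: "cmod (w 0) \<le> N" and M: "cmod (w' 0 - P) \<le> norm \<xi> * M" "cmod P \<le> M"
  defines "\<kappa> \<equiv> sqrt (4 - \<mu>\<^sup>2)"
  shows "(cmod (w t - profile \<mu> P t \<xi>))\<^sup>2 \<le>
    ((1 + 4 / \<kappa> + 8 / \<kappa>\<^sup>2) * (M + N))\<^sup>2 * decay_weight \<mu> t \<xi>"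
proof -
  define r where "r = norm \<xi>"
  have r: "r > 0" using \<xi> by (simp add: r_def)
  define \<omega> where "\<omega> = r * sqrt (4 - (\<mu> * ln (1 + r) / r)\<^sup>2) / 2"
  define a where "a = \<mu> * ln (1 + r) / 2"
  define E where "E = (1 + r) powr (- (t * \<mu> / 2))"
  define s where "s = sin (\<omega> * t)"
  define s0 where "s0 = sin (r * \<kappa> / 2 * t)"
  note fr = frequency_estimates[OF \<mu> r, folded \<kappa>_def \<omega>_def]
  have r\<kappa>: "r * \<kappa> / 2 > 0" using r fr(1) by simp
  have \<omega>: "\<omega> > 0" using fr(2) r\<kappa> by linarith
  have inv\<omega>: "1 / \<omega> \<le> 2 / (r * \<kappa>)"
    using frac_le[of 1 1 "r * \<kappa> / 2" \<omega>] fr(2) r\<kappa> by simp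
  have E: "E \<ge> 0" "E\<^sup>2 = (1 + r) powr (- (t * \<mu>))" "exp (- a * t) = E"
    using r by (simp_all only: E_def powr_ge_zero powr_half_square) (simp add: powr_def a_def)
  have M0: "M \<ge> 0" using M(2) norm_ge_zero order_trans by blast
  have N0: "N \<ge> 0" using N norm_ge_zero order_trans by blast
  have a: "0 \<le> a" "a \<le> r"
  proof -
    have "0 \<le> ln (1 + r)" "ln (1 + r) \<le> r" using r ln_add_one_self_le_self[of r] by auto
    moreover have "\<mu> * ln (1 + r) \<le> 2 * r" using \<mu> calculation by (intro mult_mono) auto
    ultimately show "0 \<le> a" "a \<le> r" using \<mu> by (auto simp: a_def)
  qed
  have "w t = complex_of_real (exp (- a * t)) *
    (complex_of_real (cos (\<omega> * t)) * w 0 + complex_of_real (sin (\<omega> * t) / \<omega>) * (w' 0 + complex_of_real a * w 0))"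
  proof (rule damped_oscillator_solution[OF w w' _ t])
    fix \<tau> :: real assume "\<tau> \<ge> 0"
    moreover have "a\<^sup>2 + \<omega>\<^sup>2 = (norm \<xi>)\<^sup>2" using fr(4) by (simp add: a_def r_def)
    moreover have "2 * a = \<mu> * L_symbol \<xi>" by (simp add: a_def L_symbol_def r_def)
    ultimately show "w'' \<tau> + complex_of_real (2 * a) * w' \<tau> + complex_of_real (a\<^sup>2 + \<omega>\<^sup>2) * w \<tau> = 0"
      using ode[of \<tau>] by (simp only:)
  qed (use \<omega> in auto)
  moreover have "profile \<mu> P t \<xi> = complex_of_real (E * (1 / \<omega>) * s0) * P"
    unfolding profile_eq r_def[symmetric] \<kappa>_def[symmetric] \<omega>_def[symmetric] E_def[symmetric] s0_def ..
  ultimately have diff: "w t - profile \<mu> P t \<xi> = complex_of_real E *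
      (complex_of_real (cos (\<omega> * t)) * w 0 + complex_of_real (s * (1 / \<omega>) * a) * w 0
        + complex_of_real (s * (1 / \<omega>)) * (w' 0 - P) + complex_of_real ((s - s0) * (1 / \<omega>)) * P)"
    unfolding E(3) s_def[symmetric] by (simp add: divide_inverse algebra_simps)
  have t1: "cmod (complex_of_real (cos (\<omega> * t)) * w 0) \<le> 1 * N"
    unfolding norm_mult norm_of_real by (intro mult_mono N) auto
  have sw: "\<bar>s * (1 / \<omega>)\<bar> \<le> 1 * (2 / (r * \<kappa>))"
    unfolding abs_mult using \<omega> inv\<omega> by (intro mult_mono) (auto simp: s_def)
  have t2: "cmod (complex_of_real (s * (1 / \<omega>) * a) * w 0) \<le> (1 * (2 / (r * \<kappa>))) * r * N"
    unfolding norm_mult norm_of_real abs_mult[of _ a]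
    by (rule mult_mono[OF mult_mono[OF sw]]) (use a N r r\<kappa> N0 fr(1) in auto)
  have t3: "cmod (complex_of_real (s * (1 / \<omega>)) * (w' 0 - P)) \<le> (1 * (2 / (r * \<kappa>))) * (r * M)"
    unfolding norm_mult norm_of_real
    by (rule mult_mono[OF sw]) (use M(1) r fr(1) in \<open>auto simp: r_def[symmetric]\<close>)
  have "\<bar>s - s0\<bar> \<le> \<bar>\<omega> * t - r * \<kappa> / 2 * t\<bar>" unfolding s_def s0_def by (rule abs_sin_diff_le)
  also have "\<dots> = \<bar>\<omega> - r * \<kappa> / 2\<bar> * t" by (simp only: left_diff_distrib[symmetric] abs_mult abs_of_nonneg[OF t])
  also have "\<dots> \<le> 4 * r\<^sup>2 / \<kappa> * t" using fr(3) t by (rule mult_right_mono)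
  finally have ss0: "\<bar>s - s0\<bar> \<le> 4 * r\<^sup>2 / \<kappa> * t" .
  have t4: "cmod (complex_of_real ((s - s0) * (1 / \<omega>)) * P) \<le> (4 * r\<^sup>2 / \<kappa> * t) * (2 / (r * \<kappa>)) * M"
    unfolding norm_mult norm_of_real abs_mult
    by (rule mult_mono[OF mult_mono[OF ss0]]) (use inv\<omega> \<omega> M(2) t r fr(1) in auto)
  \<comment> \<open>in terms of \<open>k\<close> all bounds are polynomials with nonnegative coefficients\<close>
  define k where "k = 1 / \<kappa>"
  have k: "k > 0" using fr(1) by (simp add: k_def)
  have k_eqs: "(1 * (2 / (r * \<kappa>))) * r * N = 2 * k * N" "(1 * (2 / (r * \<kappa>))) * (r * M) = 2 * k * M"
    "(4 * r\<^sup>2 / \<kappa> * t) * (2 / (r * \<kappa>)) * M = 8 * k\<^sup>2 * (r * t) * M"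
    "1 + 4 / \<kappa> + 8 / \<kappa>\<^sup>2 = 1 + 4 * k + 8 * k\<^sup>2"
    using r fr(1) by (simp_all add: k_def power2_eq_square)
  have "cmod (complex_of_real (cos (\<omega> * t)) * w 0 + complex_of_real (s * (1 / \<omega>) * a) * w 0
        + complex_of_real (s * (1 / \<omega>)) * (w' 0 - P) + complex_of_real ((s - s0) * (1 / \<omega>)) * P)
      \<le> 1 * N + 2 * k * N + 2 * k * M + 8 * k\<^sup>2 * (r * t) * M"
    using t1 t2 t3 t4 unfolding k_eqs by (intro norm_triangle_le add_mono) 
  also have "\<dots> \<le> (1 + 4 * k + 8 * k\<^sup>2) * (M + N) * (1 + r * t)"
  proof -
    have nn: "0 \<le> r * t" "0 \<le> k * N" "0 \<le> k * M" "0 \<le> k\<^sup>2 * M" "0 \<le> k\<^sup>2 * N"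
      "0 \<le> (r * t) * (k * M)" "0 \<le> (r * t) * (k * N)" "0 \<le> (r * t) * M" "0 \<le> (r * t) * N"
      "0 \<le> (r * t) * (k\<^sup>2 * N)" "0 \<le> (r * t) * (k\<^sup>2 * M)"
      using r t k M0 N0 by auto
    have "(1 + 4 * k + 8 * k\<^sup>2) * (M + N) * (1 + r * t) =
      M + N + 4 * (k * M) + 4 * (k * N) + 8 * (k\<^sup>2 * M) + 8 * (k\<^sup>2 * N) + (r * t) * M + (r * t) * N
      + 4 * ((r * t) * (k * M)) + 4 * ((r * t) * (k * N)) + 8 * ((r * t) * (k\<^sup>2 * M)) + 8 * ((r * t) * (k\<^sup>2 * N))"
      by (simp add: algebra_simps)
    moreover have "1 * N + 2 * k * N + 2 * k * M + 8 * k\<^sup>2 * (r * t) * M =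
        N + 2 * (k * N) + 2 * (k * M) + 8 * ((r * t) * (k\<^sup>2 * M))" by simp
    ultimately show ?thesis using nn M0 N0 by linarith
  qed
  finally have "cmod (w t - profile \<mu> P t \<xi>) \<le> E * ((1 + 4 * k + 8 * k\<^sup>2) * (M + N) * (1 + r * t))"
    unfolding diff norm_mult[of "complex_of_real E"] norm_of_real using E(1) by (simp add: mult_left_mono)
  then have "(cmod (w t - profile \<mu> P t \<xi>))\<^sup>2 \<le> (E * ((1 + 4 * k + 8 * k\<^sup>2) * (M + N) * (1 + r * t)))\<^sup>2"
    by (rule power_mono) simp
  also have "\<dots> = ((1 + 4 * k + 8 * k\<^sup>2) * (M + N))\<^sup>2 * ((1 + r * t)\<^sup>2 * E\<^sup>2)"
    by (simp only: power_mult_distrib mult_ac)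
  finally show ?thesis unfolding k_eqs(4) decay_weight_def E(2) r_def .
qed

text \<open>For \<open>t \<ge> T\<close> the bound at almost every frequency is integrated against Lebesgue measure, and
  Plancherel's theorem carries the result to \<open>u t\<close>.\<close>

theorem theorem1p1:
  fixes \<mu> :: real
  assumes "0 < \<mu>" and "\<mu> < 2"
  shows "\<exists>C>0. \<forall>(u0 :: real ^ 'n \<Rightarrow> complex) u1 u.
    u0 \<in> H1_space \<inter> L1_space \<longrightarrow> u1 \<in> L2_space \<inter> L11_space \<longrightarrow> mild_solution \<mu> u0 u1 u \<longrightarrow>
    (\<forall>\<^sub>F t in at_top.
       profile \<mu> (LINT x|lborel. u1 x) t \<in> (L2_space :: (real ^ 'n \<Rightarrow> complex) set) \<and>
       L2_norm (\<lambda>x. u t x - inverse_fourier (profile \<mu> (LINT x|lborel. u1 x) t) x)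
         \<le> C * (L11_norm u1 + L1_norm u0) * t powr (- (real CARD('n) / 2)))"
proof -
  obtain W T where W: "W > 0" and T: "T > 0"
    and decay: "\<And>t. t \<ge> T \<Longrightarrow> integrable lborel (decay_weight \<mu> t :: real ^ 'n \<Rightarrow> real)"
      "\<And>t. t \<ge> T \<Longrightarrow> (LINT \<xi>|lborel. decay_weight \<mu> t (\<xi> :: real ^ 'n)) \<le> W * t powr (- real DIM(real ^ 'n))"
    using decay_weight_integral_bound[OF assms(1), where 'a="real ^ 'n"] by blast
  define \<kappa> where "\<kappa> = sqrt (4 - \<mu>\<^sup>2)"
  have \<kappa>: "\<kappa> > 0" using frequency_estimates(1)[OF assms, of 1] by (simp add: \<kappa>_def)
  define A where "A = 1 + 4 / \<kappa> + 8 / \<kappa>\<^sup>2"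
  have A: "A > 0" using \<kappa> by (simp add: A_def add_pos_pos)
  let ?K = "fourier_const TYPE('n)"
  have K: "?K > 0" by simp
  show ?thesis
  proof (intro exI[of _ "A * sqrt W / ?K"] conjI allI impI)
    show "A * sqrt W / ?K > 0" using A W K by simp
    fix u0 u1 :: "real ^ 'n \<Rightarrow> complex" and u
    assume u0: "u0 \<in> H1_space \<inter> L1_space" and u1: "u1 \<in> L2_space \<inter> L11_space"
      and sol: "mild_solution \<mu> u0 u1 u"
    define P where "P = (LINT x|lborel. u1 x)"
    define D where "D = L11_norm u1 + L1_norm u0"
    have u0': "integrable lborel u0" "u0 \<in> L2_space" using u0 by (auto simp: L1_space_def H1_space_def)
    have u1': "integrable lborel u1" "u1 \<in> L2_space" "u1 \<in> L11_space"
      using u1 by (auto simp: L11_space_def L1_space_def)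
    obtain w w' w'' where
      wu: "\<And>t. t \<ge> 0 \<Longrightarrow> AE \<xi> in lborel. w t \<xi> = fourier (u t) \<xi>" and
      wode: "AE \<xi> in lborel. w 0 \<xi> = fourier u0 \<xi> \<and> w' 0 \<xi> = fourier u1 \<xi> \<and>
        (\<forall>t\<ge>0. ((\<lambda>s. w s \<xi>) has_vector_derivative w' t \<xi>) (at t within {0..}) \<and>
          ((\<lambda>s. w' s \<xi>) has_vector_derivative w'' t \<xi>) (at t within {0..}) \<and>
          w'' t \<xi> + complex_of_real (\<mu> * L_symbol \<xi>) * w' t \<xi> + complex_of_real ((norm \<xi>)\<^sup>2) * w t \<xi> = 0)"
      using sol unfolding mild_solution_def by blast
    have P: "cmod P \<le> L11_norm u1" unfolding P_def by (rule mean_le_L11_norm[OF u1'(3)])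
    have D0: "D \<ge> 0"
      using order_trans[OF norm_ge_zero P] unfolding D_def L1_norm_def
      by (intro add_nonneg_nonneg Bochner_Integration.integral_nonneg) auto
    have goal: "profile \<mu> P t \<in> (L2_space :: (real ^ 'n \<Rightarrow> complex) set) \<and>
       L2_norm (\<lambda>x. u t x - inverse_fourier (profile \<mu> P t) x) \<le> A * sqrt W / ?K * D * t powr (- (real CARD('n) / 2))"
      if t: "t \<ge> T" for t
    proof
      have t0: "t > 0" using t T by linarith
      show prof: "profile \<mu> P t \<in> (L2_space :: (real ^ 'n \<Rightarrow> complex) set)"
        by (rule L2_bound[where g="\<lambda>\<xi>. (t * cmod P)\<^sup>2 * decay_weight \<mu> t \<xi>"])
          (use profile_square_bound[OF assms, of t P] t0 decay(1)[OF t] in auto)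
      have ut: "u t \<in> L2_space" using sol t0 by (auto simp: mild_solution_def H1_space_def)
      have F: "(\<lambda>\<xi>. fourier (u t) \<xi> - profile \<mu> P t \<xi>) \<in> L2_space"
        by (rule L2_diff[OF has_fourier_L2(2)[OF has_fourier_fourier[OF ut]] prof])
      have "AE \<xi> in lborel. (cmod (fourier (u t) \<xi> - profile \<mu> P t \<xi>))\<^sup>2 \<le> (A * D)\<^sup>2 * decay_weight \<mu> t \<xi>"
        using wu[OF less_imp_le[OF t0]] wode fourier_eq_fourier_integral[OF u0']
          fourier_eq_fourier_integral[OF u1'(1,2)] AE_lborel_singleton[of 0]
      proof eventually_elim
        case (elim \<xi>)
        have "(cmod (w t \<xi> - profile \<mu> P t \<xi>))\<^sup>2 \<le> ((1 + 4 / sqrt (4 - \<mu>\<^sup>2) + 8 / (sqrt (4 - \<mu>\<^sup>2))\<^sup>2) *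
            (L11_norm u1 + L1_norm u0))\<^sup>2 * decay_weight \<mu> t \<xi>"
        proof (rule solution_minus_profile_bound[OF assms, where w="\<lambda>s. w s \<xi>" and w'="\<lambda>s. w' s \<xi>" and w''="\<lambda>s. w'' s \<xi>"])
          show "cmod (w 0 \<xi>) \<le> L1_norm u0"
            using elim fourier_integral_bound[OF u0'(1)] by simp
          show "cmod (w' 0 \<xi> - P) \<le> norm \<xi> * L11_norm u1"
            using elim fourier_integral_minus_mean[OF u1'(3)] by (simp add: P_def)
        qed (use elim t0 P in auto)
        then show ?case using elim(1) by (simp add: A_def D_def \<kappa>_def)
      qed
      then have "(L2_norm (\<lambda>\<xi>. fourier (u t) \<xi> - profile \<mu> P t \<xi>))\<^sup>2 \<le> (LINT \<xi>|lborel. (A * D)\<^sup>2 * decay_weight \<mu> t (\<xi>::real^'n))"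
        unfolding L2_norm_square
        by (intro integral_mono_AE L2_integrable[OF F] integrable_mult_right decay(1)[OF t])
      also have "\<dots> = (A * D)\<^sup>2 * (LINT \<xi>|lborel. decay_weight \<mu> t (\<xi>::real^'n))"
        by (rule integral_mult_right_zero)
      also have "\<dots> \<le> (A * D)\<^sup>2 * (W * t powr (- real DIM(real ^ 'n)))"
        by (intro mult_left_mono decay(2)[OF t]) auto
      also have "\<dots> = (A * sqrt W * D * t powr (- (real CARD('n) / 2)))\<^sup>2"
        using W by (simp add: power_mult_distrib powr_half_square)
      finally have "L2_norm (\<lambda>\<xi>. fourier (u t) \<xi> - profile \<mu> P t \<xi>) \<le> A * sqrt W * D * t powr (- (real CARD('n) / 2))"
        by (rule power2_le_imp_le) (use A D0 W in simp)
      then have "?K * L2_norm (\<lambda>x. u t x - inverse_fourier (profile \<mu> P t) x) \<le> A * sqrt W * D * t powr (- (real CARD('n) / 2))"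
        by (simp only: L2_norm_diff_inverse_fourier[OF ut prof])
      then show "L2_norm (\<lambda>x. u t x - inverse_fourier (profile \<mu> P t) x) \<le> A * sqrt W / ?K * D * t powr (- (real CARD('n) / 2))"
        using K by (simp add: pos_le_divide_eq mult.commute)
    qed
    show "\<forall>\<^sub>F t in at_top. profile \<mu> (LINT x|lborel. u1 x) t \<in> (L2_space :: (real ^ 'n \<Rightarrow> complex) set) \<and>
       L2_norm (\<lambda>x. u t x - inverse_fourier (profile \<mu> (LINT x|lborel. u1 x) t) x)
         \<le> A * sqrt W / ?K * (L11_norm u1 + L1_norm u0) * t powr (- (real CARD('n) / 2))"
      using eventually_ge_at_top[of T] by eventually_elim (use goal in \<open>simp only: P_def D_def\<close>)
  qed
qed

end
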